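(* Assume $\lambda^{a,o}(\delta)=\lambda^{b,o}(\delta)=A e^{-k\delta}$ with constants $A,k>0$, and that the option position is Delta-hedged at every time $t$. Let $$M(s_t,\nu_t,t)=-\frac{\gamma}{2}\xi^2E_t\left[\int_t^T\nu_uC_\nu^2(S_u,\nu_u,u)\,du\right].$$ Then the approximate optimal controls produced by the approximate treatment described in the context are $$\hat\delta_{t,*}^{a,o}=\frac1k+M(s_t,\nu_t,t)(2q_t^o-1),\qquad \hat\delta_{t,*}^{b,o}=\frac1k-M(s_t,\nu_t,t)(2q_t^o+1).$$ Moreover the approximate value function is $$\tilde V(s_t,\nu_t,q_t^o,t)=-\frac{\gamma}{2}\xi^2E_t\left[\int_t^T\nu_uC_\nu^2(S_u,\nu_u,u)\,du\right](q_t^o)^2,$$ which is identical to the value function of the inactive trader (one who makes no option trades, so that the option inventory stays equal to $q_t^o$ on $[t,T]$), and the exact value function satisfies $$V(s_t,\nu_t,q_t^o,t)\ge\tilde V(s_t,\nu_t,q_t^o,t).$$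
   Context: Model. $dS_t=\sqrt{\nu_t}\,dW_t$, $d\nu_t=\theta(\alpha-\nu_t)dt+\xi\sqrt{\nu_t}\,dB_t$, with constants $\theta,\alpha,\xi>0$, $\nu\ge0$, $W=\rho B+\sqrt{1-\rho^2}\,\tilde B$, where $B,\tilde B$ are independent standard Brownian motions. $E_t[\cdot]=E[\cdot\mid\mathcal F_t]$ (with $S_t=s_t$). The interest rate is $0$. $C(s,\nu,t)$ is the mid-price function of a European call with maturity $T$ and strike $K$, a smooth solution of $C_t+\frac12\nu C_{ss}+\xi\rho\nu C_{s\nu}+\frac12\xi^2\nu C_{\nu\nu}+[\theta(\alpha-\nu)-\lambda^\nu(s,\nu,t)]C_\nu=0$, $C(s,\nu,T)=(s-K)^+$, where $\lambda^\nu$ is a given price of volatility risk; $C_\nu=\partial C/\partial\nu$. The expectation defining $M$ is assumed finite. A dealer makes markets in the option, choosing real-valued state-feedback premiums $\delta_t^{a,o},\delta_t^{b,o}$ around the option mid-price. The numbers of options sold/bought $N^{a,o},N^{b,o}$ are independent (conditionally on the controls) Poisson-type counting processes, independent of the Brownian motions, with intensities $\lambda^{a,o}(\delta_t^{a,o}),\lambda^{b,o}(\delta_t^{b,o})$; the option inventory is integer valued with $dq_t^o=dN_t^{b,o}-dN_t^{a,o}$. Delta-hedging means the stock inventory is $q_t^s=-q_t^oC_s(S_t,\nu_t,t)$ at all times, so that the inventory value process $dI_t=q_t^sdS_t+q_t^odC_t$ has quadratic variation $\nu_t\xi^2C_\nu^2(q_t^o)^2dt$. $\gamma\ge0$ is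 a constant. Value function: $$V(s_t,\nu_t,q_t^o,t)=\max_{(\delta_u^{a,o},\delta_u^{b,o})_{u\in[t,T]}}E_t\left[\int_t^T\delta_u^{a,o}dN_u^{a,o}+\delta_u^{b,o}dN_u^{b,o}-\frac\gamma2\int_t^T\nu_u\xi^2C_\nu^2(S_u,\nu_u,u)(q_u^o)^2du\right],$$ assumed sufficiently smooth (of class $\mathcal C^{1,2,2}$ in $(t,s,\nu)$). For the exponential intensities the exact optimal premiums are $\delta_{t,*}^{a,o}=\frac1k+V(s,\nu,q^o,t)-V(s,\nu,q^o-1,t)$ and $\delta_{t,*}^{b,o}=\frac1k+V(s,\nu,q^o,t)-V(s,\nu,q^o+1,t)$, and $V$ satisfies $$V_t+\theta(\alpha-\nu)V_\nu+\tfrac12\nu V_{ss}+\xi\rho\nu V_{s\nu}+\tfrac12\xi^2\nu V_{\nu\nu}-\tfrac\gamma2\nu\xi^2C_\nu^2(q^o)^2+\tfrac Ak\left(e^{-k\delta_{t,*}^{a,o}}+e^{-k\delta_{t,*}^{b,o}}\right)=0,\quad V|_{t=T}=0.\quad( * )$$ Approximate treatment (following Avellaneda and Stoikov, 2008): (1) replace $V$ by a quadratic polynomial $\tilde V=V^{(0)}+V^{(1)}q^o+V^{(2)}(q^o)^2$ with coefficients depending on $(s,\nu,t)$ and with the convention $V^{(0)}\equiv0$; (2) in $( * )$ replace the order arrival term by its first-order expansion $\frac Ak\left(2-k(\delta_{t,*}^{a,o}+\delta_{t,*}^{b,o})\right)$, the premiums being computed with $\tilde V$ in place of $V$; (3)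 determine $V^{(1)},V^{(2)}$ by equating to zero the coefficients of $q^o$ and $(q^o)^2$ in the resulting equation, with zero terminal conditions at $T$, taking the solutions given by the Feynman-Kac representation. The approximate controls are obtained by replacing $V$ with $\tilde V$ in the formulas for the optimal premiums. *)

theory Defs
  imports "HOL-Probability.Probability" "HOL-Computational_Algebra.Polynomial"
begin

section \<open>Driving noise\<close>

text \<open>
  Two independent standard Brownian motions relative to the filtration \<open>F\<close>: over each time step the
  two increments are independent of each other and of the past.
\<close>

definition brownian_pair ::
    "'w measure \<Rightarrow> (real \<Rightarrow> 'w measure) \<Rightarrow> (real \<Rightarrow> 'w \<Rightarrow> real) \<Rightarrow> (real \<Rightarrow> 'w \<Rightarrow> real) \<Rightarrow> bool" where
  "brownian_pair M F B B' \<longleftrightarrow>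
     (\<forall>W\<in>{B, B'}.
        (\<forall>\<omega>\<in>space M. W 0 \<omega> = 0 \<and> continuous_on {0..} (\<lambda>t. W t \<omega>)) \<and>
        (\<forall>t\<ge>0. W t \<in> borel_measurable (F t)) \<and>
        (\<forall>t\<ge>0. \<forall>u>t. distributed M lborel (\<lambda>\<omega>. W u \<omega> - W t \<omega>) (normal_density 0 (sqrt (u - t))))) \<and>
     (\<forall>t\<ge>0. \<forall>u>t. prob_space.indep_sets M
        (\<lambda>i. [sets (F t),
              sets (vimage_algebra (space M) (\<lambda>\<omega>. B u \<omega> - B t \<omega>) borel),
              sets (vimage_algebra (space M) (\<lambda>\<omega>. B' u \<omega> - B' t \<omega>) borel)] ! i) {..<3::nat})"

definition standard_poisson :: "'w measure \<Rightarrow> (real \<Rightarrow> 'w \<Rightarrow> nat) \<Rightarrow> bool" where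
  "standard_poisson M P \<longleftrightarrow>
     (\<forall>u\<ge>0. P u \<in> measurable M (count_space UNIV)) \<and>
     (\<forall>\<omega>\<in>space M. P 0 \<omega> = 0 \<and> mono_on {0..} (\<lambda>u. P u \<omega>) \<and>
        (\<forall>u\<ge>0. continuous (at_right u) (\<lambda>r. P r \<omega>))) \<and>
     (\<forall>u\<ge>0. \<forall>w>u. distr M (count_space UNIV) (\<lambda>\<omega>. P w \<omega> - P u \<omega>) = measure_pmf (poisson_pmf (w - u))) \<and>
     (\<forall>(\<tau>::nat \<Rightarrow> real) n. 0 \<le> \<tau> 0 \<and> strict_mono \<tau> \<longrightarrow>
        prob_space.indep_vars M (\<lambda>_. count_space UNIV) (\<lambda>i \<omega>. P (\<tau> (Suc i)) \<omega> - P (\<tau> i) \<omega>) {..<n})"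

definition process_sigma :: "'w measure \<Rightarrow> (real \<Rightarrow> 'w \<Rightarrow> nat) \<Rightarrow> 'w set set" where
  "process_sigma M P = sigma_sets (space M) {P u -` A \<inter> space M | u A. 0 \<le> u}"

text \<open>
  \<open>X = \<integral>\<^sub>t\<^sup>u H dW\<close> as limit in probability of left-point Riemann sums. For continuous adapted \<open>H\<close>
  and a Brownian motion \<open>W\<close> this determines the It\^o integral up to a null set.
\<close>

definition is_ito_integral ::
    "'w measure \<Rightarrow> real \<Rightarrow> real \<Rightarrow> (real \<Rightarrow> 'w \<Rightarrow> real) \<Rightarrow> (real \<Rightarrow> 'w \<Rightarrow> real) \<Rightarrow> ('w \<Rightarrow> real) \<Rightarrow> bool" where
  "is_ito_integral M t u H W X \<longleftrightarrow>
     (let r = (\<lambda>n i. t + (u - t) * real i / real n) in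
      \<forall>\<epsilon>>0. (\<lambda>n. measure M {\<omega>\<in>space M.
          \<epsilon> \<le> \<bar>(\<Sum>i<n. H (r n i) \<omega> * (W (r n (Suc i)) \<omega> - W (r n i) \<omega>)) - X \<omega>\<bar>}) \<longlonglongrightarrow> 0)"


section \<open>The market\<close>

text \<open>
  \<open>stock X t s v\<close> and \<open>vari X t s v\<close> are the stock price and its instantaneous variance on
  \<open>[t, T]\<close>, started at time \<open>t\<close> from \<open>(s, v)\<close>; thus \<open>E\<^sub>t\<close> at the state \<open>(s, v)\<close> is the plain
  expectation of a functional of these processes. \<open>hedge X s v q t\<close> is the stock inventory that
  the dealer holds together with the option inventory \<open>q\<close>.
\<close>

record 'w dealer_model =
  pspace :: "'w measure"
  filt :: "real \<Rightarrow> 'w measure"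
  bm :: "real \<Rightarrow> 'w \<Rightarrow> real"
  bm_perp :: "real \<Rightarrow> 'w \<Rightarrow> real"
  clock_a :: "real \<Rightarrow> 'w \<Rightarrow> nat"
  clock_b :: "real \<Rightarrow> 'w \<Rightarrow> nat"
  stock :: "real \<Rightarrow> real \<Rightarrow> real \<Rightarrow> real \<Rightarrow> 'w \<Rightarrow> real"
  vari :: "real \<Rightarrow> real \<Rightarrow> real \<Rightarrow> real \<Rightarrow> 'w \<Rightarrow> real"
  theta :: real
  alpha :: real
  xi :: real
  rho :: real
  gam :: real
  horizon :: real
  lam_a :: "real \<Rightarrow> real"
  lam_b :: "real \<Rightarrow> real"
  call :: "real \<Rightarrow> real \<Rightarrow> real \<Rightarrow> real"
  hedge :: "real \<Rightarrow> real \<Rightarrow> int \<Rightarrow> real \<Rightarrow> real"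

definition heston_solution ::
    "'w dealer_model \<Rightarrow> real \<Rightarrow> real \<Rightarrow> real \<Rightarrow> (real \<Rightarrow> 'w \<Rightarrow> real) \<Rightarrow> (real \<Rightarrow> 'w \<Rightarrow> real) \<Rightarrow> bool" where
  "heston_solution X t s v S N \<longleftrightarrow>
     (let M = pspace X; T = horizon X; B = bm X;
          W = (\<lambda>u \<omega>. rho X * bm X u \<omega> + sqrt (1 - (rho X)\<^sup>2) * bm_perp X u \<omega>) in
      (\<forall>u\<in>{t..T}. S u \<in> borel_measurable (filt X u) \<and> N u \<in> borel_measurable (filt X u)) \<and>
      (\<forall>\<omega>\<in>space M. S t \<omega> = s \<and> N t \<omega> = v \<and> (\<forall>u\<in>{t..T}. 0 \<le> N u \<omega>) \<and>
         continuous_on {t..T} (\<lambda>u. S u \<omega>) \<and> continuous_on {t..T} (\<lambda>u. N u \<omega>)) \<and>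
      (\<forall>u\<in>{t..T}.
         is_ito_integral M t u (\<lambda>r \<omega>. sqrt (N r \<omega>)) W (\<lambda>\<omega>. S u \<omega> - s) \<and>
         is_ito_integral M t u (\<lambda>r \<omega>. xi X * sqrt (N r \<omega>)) B
           (\<lambda>\<omega>. N u \<omega> - v - (LBINT r=t..u. theta X * (alpha X - N r \<omega>)))))"

definition heston_market :: "'w dealer_model \<Rightarrow> bool" where
  "heston_market X \<longleftrightarrow>
     0 < theta X \<and> 0 < alpha X \<and> 0 < xi X \<and> -1 \<le> rho X \<and> rho X \<le> 1 \<and> 0 \<le> gam X \<and> 0 < horizon X \<and>
     prob_space (pspace X) \<and>
     filtration (space (pspace X)) (filt X) \<and> (\<forall>t. subalgebra (pspace X) (filt X t)) \<and>
     brownian_pair (pspace X) (filt X) (bm X) (bm_perp X) \<and>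
     (\<forall>t\<in>{0..horizon X}. \<forall>s. \<forall>v\<ge>0. heston_solution X t s v (stock X t s v) (vari X t s v))"

text \<open>
  The Poisson clocks that drive the order arrivals are independent of each other and of the
  filtration carrying the Brownian motions and the market state.
\<close>

definition order_clocks :: "'w dealer_model \<Rightarrow> bool" where
  "order_clocks X \<longleftrightarrow>
     standard_poisson (pspace X) (clock_a X) \<and> standard_poisson (pspace X) (clock_b X) \<and>
     (\<forall>t\<ge>0. prob_space.indep_sets (pspace X)
        (\<lambda>i. [sets (filt X t), process_sigma (pspace X) (clock_a X), process_sigma (pspace X) (clock_b X)] ! i)
        {..<3::nat})"


section \<open>Differential operators\<close>

definition d_s :: "(real \<Rightarrow> real \<Rightarrow> real \<Rightarrow> real) \<Rightarrow> real \<Rightarrow> real \<Rightarrow> real \<Rightarrow> real" where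
  "d_s U s v t = deriv (\<lambda>x. U x v t) s"

definition d_v :: "(real \<Rightarrow> real \<Rightarrow> real \<Rightarrow> real) \<Rightarrow> real \<Rightarrow> real \<Rightarrow> real \<Rightarrow> real" where
  "d_v U s v t = deriv (\<lambda>x. U s x t) v"

definition d_t :: "(real \<Rightarrow> real \<Rightarrow> real \<Rightarrow> real) \<Rightarrow> real \<Rightarrow> real \<Rightarrow> real \<Rightarrow> real" where
  "d_t U s v t = deriv (\<lambda>x. U s v x) t"

text \<open>
  \<open>\<C>\<^sup>1\<^sup>,\<^sup>2\<^sup>,\<^sup>2\<close> in \<open>(t, s, v)\<close> on the open region \<open>v > 0\<close>, \<open>0 < t < T\<close>, and continuous up to its
  boundary, so that terminal values are attained.
\<close>

definition C122 :: "real \<Rightarrow> (real \<Rightarrow> real \<Rightarrow> real \<Rightarrow> real) \<Rightarrow> bool" where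
  "C122 T U \<longleftrightarrow>
     continuous_on (UNIV \<times> {0..} \<times> {0..T}) (\<lambda>(s, v, t). U s v t) \<and>
     (\<forall>s. \<forall>v>0. \<forall>t\<in>{0<..<T}.
        (\<lambda>x. U s v x) field_differentiable at t \<and>
        (\<forall>G\<in>{U, d_s U, d_v U}.
          (\<lambda>x. G x v t) field_differentiable at s \<and> (\<lambda>x. G s x t) field_differentiable at v)) \<and>
     (\<forall>G\<in>{d_t U, d_s U, d_v U, d_s (d_s U), d_v (d_s U), d_s (d_v U), d_v (d_v U)}.
        continuous_on (UNIV \<times> {0<..} \<times> {0<..<T}) (\<lambda>(s, v, t). G s v t))"

definition heston_operator ::
    "'w dealer_model \<Rightarrow> real \<Rightarrow> (real \<Rightarrow> real \<Rightarrow> real \<Rightarrow> real) \<Rightarrow> real \<Rightarrow> real \<Rightarrow> real \<Rightarrow> real" where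
  "heston_operator X b U s v t =
     d_t U s v t + b * d_v U s v t + 1 / 2 * v * d_s (d_s U) s v t
     + xi X * rho X * v * d_v (d_s U) s v t + 1 / 2 * (xi X)\<^sup>2 * v * d_v (d_v U) s v t"

definition call_price :: "'w dealer_model \<Rightarrow> (real \<Rightarrow> real \<Rightarrow> real \<Rightarrow> real) \<Rightarrow> real \<Rightarrow> bool" where
  "call_price X lam_nu K \<longleftrightarrow>
     C122 (horizon X) (call X) \<and>
     (\<forall>s. \<forall>v>0. \<forall>t\<in>{0<..<horizon X}.
        heston_operator X (theta X * (alpha X - v) - lam_nu s v t) (call X) s v t = 0) \<and>
     (\<forall>s. \<forall>v\<ge>0. call X s v (horizon X) = max (s - K) 0)"


section \<open>The dealer's control problem\<close>

text \<open>
  Rate \<open>d[I]\<^sub>t/dt\<close> of the quadratic variation of the inventory value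
  \<open>dI = qs dS + qo dC(S, \<nu>, t)\<close>: by It\^o's formula the martingale part of \<open>dI\<close> is
  \<open>(qs + qo C\<^sub>s) \<surd>\<nu> dW + qo \<xi> \<surd>\<nu> C\<^sub>\<nu> dB\<close> with \<open>d[W, B] = \<rho> dt\<close>.
\<close>

definition inventory_variance_rate ::
    "'w dealer_model \<Rightarrow> real \<Rightarrow> real \<Rightarrow> real \<Rightarrow> real \<Rightarrow> real \<Rightarrow> real" where
  "inventory_variance_rate X qs qo s v t =
     (let e = qs + qo * d_s (call X) s v t; c = d_v (call X) s v t in
      v * (e\<^sup>2 + 2 * rho X * xi X * e * qo * c + (xi X)\<^sup>2 * c\<^sup>2 * qo\<^sup>2))"

definition delta_hedged :: "'w dealer_model \<Rightarrow> bool" where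
  "delta_hedged X \<longleftrightarrow>
     (\<forall>s. \<forall>v\<ge>0. \<forall>q. \<forall>t\<in>{0..horizon X}. hedge X s v q t = - real_of_int q * d_s (call X) s v t)"

lemma inventory_variance_rate_delta_hedged:
  assumes "delta_hedged X" "0 \<le> v" "t \<in> {0..horizon X}"
  shows "inventory_variance_rate X (hedge X s v q t) (real_of_int q) s v t
           = v * (xi X)\<^sup>2 * (d_v (call X) s v t)\<^sup>2 * (real_of_int q)\<^sup>2"
  using assms by (simp add: delta_hedged_def inventory_variance_rate_def)

text \<open>
  A state-feedback premium is a function \<open>d s v q t\<close>. It is evaluated at the option inventory just
  before the current time, so that an order is charged the premium quoted when it arrives.
\<close>

type_synonym feedback = "real \<Rightarrow> real \<Rightarrow> int \<Rightarrow> real \<Rightarrow> real"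

definition feedback_measurable :: "feedback \<Rightarrow> bool" where
  "feedback_measurable d \<longleftrightarrow>
     (\<lambda>(s, v, q, t). d s v q t)
       \<in> borel_measurable (borel \<Otimes>\<^sub>M borel \<Otimes>\<^sub>M count_space UNIV \<Otimes>\<^sub>M borel)"

definition option_inventory ::
    "int \<Rightarrow> (real \<Rightarrow> 'w \<Rightarrow> nat) \<Rightarrow> (real \<Rightarrow> 'w \<Rightarrow> nat) \<Rightarrow> real \<Rightarrow> 'w \<Rightarrow> int" where
  "option_inventory q Na Nb u \<omega> = q + int (Nb u \<omega>) - int (Na u \<omega>)"

definition premium ::
    "'w dealer_model \<Rightarrow> feedback \<Rightarrow> real \<Rightarrow> real \<Rightarrow> real \<Rightarrow> int
      \<Rightarrow> (real \<Rightarrow> 'w \<Rightarrow> nat) \<Rightarrow> (real \<Rightarrow> 'w \<Rightarrow> nat) \<Rightarrow> real \<Rightarrow> 'w \<Rightarrow> real" where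
  "premium X d t s v q Na Nb u \<omega> =
     d (stock X t s v u \<omega>) (vari X t s v u \<omega>) (Lim (at_left u) (\<lambda>r. option_inventory q Na Nb r \<omega>)) u"

text \<open>
  The numbers of options sold and bought on \<open>[t, T]\<close> under the feedback \<open>(da, db)\<close>, as random time
  changes of the Poisson clocks: conditionally on the controls these are independent Poisson
  processes with intensities \<open>\<lambda>\<^sup>a(\<delta>\<^sup>a)\<close>, \<open>\<lambda>\<^sup>b(\<delta>\<^sup>b)\<close>. Finite integrated intensity excludes explosion.
\<close>

definition order_flow ::
    "'w dealer_model \<Rightarrow> feedback \<Rightarrow> feedback \<Rightarrow> real \<Rightarrow> real \<Rightarrow> real \<Rightarrow> int
      \<Rightarrow> (real \<Rightarrow> 'w \<Rightarrow> nat) \<Rightarrow> (real \<Rightarrow> 'w \<Rightarrow> nat) \<Rightarrow> bool" where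
  "order_flow X da db t s v q Na Nb \<longleftrightarrow>
     (let M = pspace X; T = horizon X;
          ra = (\<lambda>r \<omega>. lam_a X (premium X da t s v q Na Nb r \<omega>));
          rb = (\<lambda>r \<omega>. lam_b X (premium X db t s v q Na Nb r \<omega>)) in
      (\<forall>u\<in>{t..T}. Na u \<in> measurable M (count_space UNIV) \<and> Nb u \<in> measurable M (count_space UNIV)) \<and>
      (AE \<omega> in M.
         interval_lebesgue_integrable lborel t T (\<lambda>r. ra r \<omega>) \<and>
         interval_lebesgue_integrable lborel t T (\<lambda>r. rb r \<omega>) \<and>
         (\<forall>u\<in>{t..T}. Na u \<omega> = clock_a X (LBINT r=t..u. ra r \<omega>) \<omega> \<and>
                      Nb u \<omega> = clock_b X (LBINT r=t..u. rb r \<omega>) \<omega>)))"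

text \<open>
  \<open>\<integral>\<^sub>t\<^sup>T \<delta>\<^sub>u dN\<^sub>u\<close> as a sum over the jump times of the counting path \<open>N\<close>; along an order flow there
  are almost surely finitely many.
\<close>

definition jump_integral :: "real \<Rightarrow> real \<Rightarrow> (real \<Rightarrow> real) \<Rightarrow> (real \<Rightarrow> nat) \<Rightarrow> real" where
  "jump_integral t T \<delta> N =
     (\<Sum>u | u \<in> {t<..T} \<and> N u \<noteq> Lim (at_left u) N. \<delta> u * (real (N u) - real (Lim (at_left u) N)))"

definition premium_income ::
    "'w dealer_model \<Rightarrow> feedback \<Rightarrow> feedback \<Rightarrow> real \<Rightarrow> real \<Rightarrow> real \<Rightarrow> int
      \<Rightarrow> (real \<Rightarrow> 'w \<Rightarrow> nat) \<Rightarrow> (real \<Rightarrow> 'w \<Rightarrow> nat) \<Rightarrow> 'w \<Rightarrow> real" where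
  "premium_income X da db t s v q Na Nb \<omega> =
     jump_integral t (horizon X) (\<lambda>u. premium X da t s v q Na Nb u \<omega>) (\<lambda>u. Na u \<omega>)
     + jump_integral t (horizon X) (\<lambda>u. premium X db t s v q Na Nb u \<omega>) (\<lambda>u. Nb u \<omega>)"

definition risk_rate ::
    "'w dealer_model \<Rightarrow> real \<Rightarrow> real \<Rightarrow> real \<Rightarrow> int
      \<Rightarrow> (real \<Rightarrow> 'w \<Rightarrow> nat) \<Rightarrow> (real \<Rightarrow> 'w \<Rightarrow> nat) \<Rightarrow> real \<Rightarrow> 'w \<Rightarrow> real" where
  "risk_rate X t s v q Na Nb u \<omega> =
     (let S = stock X t s v u \<omega>; \<nu> = vari X t s v u \<omega>; qo = option_inventory q Na Nb u \<omega> in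
      inventory_variance_rate X (hedge X S \<nu> qo u) (real_of_int qo) S \<nu> u)"

definition expected_gain ::
    "'w dealer_model \<Rightarrow> feedback \<Rightarrow> feedback \<Rightarrow> real \<Rightarrow> real \<Rightarrow> real \<Rightarrow> int
      \<Rightarrow> (real \<Rightarrow> 'w \<Rightarrow> nat) \<Rightarrow> (real \<Rightarrow> 'w \<Rightarrow> nat) \<Rightarrow> real" where
  "expected_gain X da db t s v q Na Nb =
     (LINT \<omega>|pspace X. premium_income X da db t s v q Na Nb \<omega>
        - gam X / 2 * (LBINT u=t..horizon X. risk_rate X t s v q Na Nb u \<omega>))"

text \<open>Admissibility only asks that the control generates an order flow and that its gain is integrable.\<close>

definition admissible ::
    "'w dealer_model \<Rightarrow> feedback \<Rightarrow> feedback \<Rightarrow> real \<Rightarrow> real \<Rightarrow> real \<Rightarrow> int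
      \<Rightarrow> (real \<Rightarrow> 'w \<Rightarrow> nat) \<Rightarrow> (real \<Rightarrow> 'w \<Rightarrow> nat) \<Rightarrow> bool" where
  "admissible X da db t s v q Na Nb \<longleftrightarrow>
     feedback_measurable da \<and> feedback_measurable db \<and>
     order_flow X da db t s v q Na Nb \<and>
     integrable (pspace X) (premium_income X da db t s v q Na Nb) \<and>
     (AE \<omega> in pspace X. interval_lebesgue_integrable lborel t (horizon X) (\<lambda>u. risk_rate X t s v q Na Nb u \<omega>)) \<and>
     integrable (pspace X) (\<lambda>\<omega>. LBINT u=t..horizon X. risk_rate X t s v q Na Nb u \<omega>)"

definition is_value_function :: "'w dealer_model \<Rightarrow> (real \<Rightarrow> real \<Rightarrow> int \<Rightarrow> real \<Rightarrow> real) \<Rightarrow> bool" where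
  "is_value_function X V \<longleftrightarrow>
     (\<forall>t\<in>{0..horizon X}. \<forall>s. \<forall>v\<ge>0. \<forall>q.
        (\<forall>da db Na Nb. admissible X da db t s v q Na Nb \<longrightarrow>
            expected_gain X da db t s v q Na Nb \<le> V s v q t) \<and>
        (\<exists>da db Na Nb. admissible X da db t s v q Na Nb \<and>
            V s v q t = expected_gain X da db t s v q Na Nb))"

text \<open>Without option trades the premiums earn nothing, so their value is immaterial.\<close>

definition inactive_value :: "'w dealer_model \<Rightarrow> real \<Rightarrow> real \<Rightarrow> int \<Rightarrow> real \<Rightarrow> real" where
  "inactive_value X s v q t =
     expected_gain X (\<lambda>_ _ _ _. 0) (\<lambda>_ _ _ _. 0) t s v q (\<lambda>_ _. 0) (\<lambda>_ _. 0)"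

definition vega_risk :: "'w dealer_model \<Rightarrow> real \<Rightarrow> real \<Rightarrow> real \<Rightarrow> 'w \<Rightarrow> real" where
  "vega_risk X s v t \<omega> =
     (LBINT u=t..horizon X.
        vari X t s v u \<omega> * (d_v (call X) (stock X t s v u \<omega>) (vari X t s v u \<omega>) u)\<^sup>2)"

definition vega_risk_finite :: "'w dealer_model \<Rightarrow> bool" where
  "vega_risk_finite X \<longleftrightarrow>
     (\<forall>t\<in>{0..horizon X}. \<forall>s. \<forall>v\<ge>0.
        (AE \<omega> in pspace X. interval_lebesgue_integrable lborel t (horizon X)
           (\<lambda>u. vari X t s v u \<omega> * (d_v (call X) (stock X t s v u \<omega>) (vari X t s v u \<omega>) u)\<^sup>2)) \<and>
        integrable (pspace X) (vega_risk X s v t))"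


section \<open>The dynamic programming equation and its approximate treatment\<close>

definition ask_premium :: "real \<Rightarrow> (real \<Rightarrow> real \<Rightarrow> int \<Rightarrow> real \<Rightarrow> real) \<Rightarrow> feedback" where
  "ask_premium k U s v q t = 1 / k + U s v q t - U s v (q - 1) t"

definition bid_premium :: "real \<Rightarrow> (real \<Rightarrow> real \<Rightarrow> int \<Rightarrow> real \<Rightarrow> real) \<Rightarrow> feedback" where
  "bid_premium k U s v q t = 1 / k + U s v q t - U s v (q + 1) t"

definition arrival_exact ::
    "real \<Rightarrow> real \<Rightarrow> (real \<Rightarrow> real \<Rightarrow> int \<Rightarrow> real \<Rightarrow> real) \<Rightarrow> real \<Rightarrow> real \<Rightarrow> int \<Rightarrow> real \<Rightarrow> real" where
  "arrival_exact A k U s v q t =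
     A / k * (exp (- k * ask_premium k U s v q t) + exp (- k * bid_premium k U s v q t))"

definition arrival_linear ::
    "real \<Rightarrow> real \<Rightarrow> (real \<Rightarrow> real \<Rightarrow> int \<Rightarrow> real \<Rightarrow> real) \<Rightarrow> real \<Rightarrow> real \<Rightarrow> int \<Rightarrow> real \<Rightarrow> real" where
  "arrival_linear A k U s v q t =
     A / k * (2 - k * (ask_premium k U s v q t + bid_premium k U s v q t))"

text \<open>
  Left-hand side of the dynamic programming equation for \<open>U\<close> with order arrival term \<open>arr\<close>, split
  into the differential operator and the remaining source terms.
\<close>

definition hjb_source ::
    "'w dealer_model \<Rightarrow> (real \<Rightarrow> real \<Rightarrow> int \<Rightarrow> real \<Rightarrow> real) \<Rightarrow> real \<Rightarrow> real \<Rightarrow> int \<Rightarrow> real \<Rightarrow> real" where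
  "hjb_source X arr s v q t =
     - (gam X / 2) * v * (xi X)\<^sup>2 * (d_v (call X) s v t)\<^sup>2 * (real_of_int q)\<^sup>2 + arr s v q t"

definition hjb_lhs ::
    "'w dealer_model \<Rightarrow> (real \<Rightarrow> real \<Rightarrow> int \<Rightarrow> real \<Rightarrow> real) \<Rightarrow> (real \<Rightarrow> real \<Rightarrow> int \<Rightarrow> real \<Rightarrow> real)
      \<Rightarrow> real \<Rightarrow> real \<Rightarrow> int \<Rightarrow> real \<Rightarrow> real" where
  "hjb_lhs X arr U s v q t =
     heston_operator X (theta X * (alpha X - v)) (\<lambda>s v t. U s v q t) s v t + hjb_source X arr s v q t"

definition solves_hjb ::
    "'w dealer_model \<Rightarrow> real \<Rightarrow> real \<Rightarrow> (real \<Rightarrow> real \<Rightarrow> int \<Rightarrow> real \<Rightarrow> real) \<Rightarrow> bool" where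
  "solves_hjb X A k V \<longleftrightarrow>
     (\<forall>q. (\<forall>s. \<forall>v>0. \<forall>t\<in>{0<..<horizon X}. hjb_lhs X (arrival_exact A k V) V s v q t = 0) \<and>
          (\<forall>s. \<forall>v\<ge>0. V s v q (horizon X) = 0))"

definition quadratic_in_q ::
    "(real \<Rightarrow> real \<Rightarrow> real \<Rightarrow> real) \<Rightarrow> (real \<Rightarrow> real \<Rightarrow> real \<Rightarrow> real) \<Rightarrow> (real \<Rightarrow> real \<Rightarrow> real \<Rightarrow> real)
      \<Rightarrow> real \<Rightarrow> real \<Rightarrow> int \<Rightarrow> real \<Rightarrow> real" where
  "quadratic_in_q V0 V1 V2 s v q t = V0 s v t + V1 s v t * real_of_int q + V2 s v t * (real_of_int q)\<^sup>2"

text \<open>The coefficient of \<open>q\<^sup>i\<close> in a function of \<open>q \<in> \<int>\<close> that is given by a real polynomial.\<close>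

definition q_coeff :: "(int \<Rightarrow> real) \<Rightarrow> nat \<Rightarrow> real" where
  "q_coeff f i = coeff (THE p. \<forall>q. poly p (real_of_int q) = f q) i"

text \<open>
  The Feynman-Kac representation, with running source \<open>f\<close> and zero terminal value, of the solution of
  \<open>U\<^sub>t + \<theta>(\<alpha> - \<nu>) U\<^sub>\<nu> + \<dots> + f = 0\<close>.
\<close>

definition feynman_kac ::
    "'w dealer_model \<Rightarrow> (real \<Rightarrow> real \<Rightarrow> real \<Rightarrow> real) \<Rightarrow> real \<Rightarrow> real \<Rightarrow> real \<Rightarrow> real" where
  "feynman_kac X f s v t =
     (LINT \<omega>|pspace X. LBINT u=t..horizon X. f (stock X t s v u \<omega>) (vari X t s v u \<omega>) u)"

text \<open>
  \<open>V1\<close>, \<open>V2\<close> result from the treatment: with \<open>U = V1 q + V2 q\<^sup>2\<close> and the linearised arrival term, the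
  coefficients of \<open>q\<close> and \<open>q\<^sup>2\<close> of the equation vanish; \<open>V1\<close>, \<open>V2\<close> vanish at \<open>T\<close> and are represented
  by Feynman-Kac with the source terms of the respective coefficient equation.
\<close>

definition approximate_treatment ::
    "'w dealer_model \<Rightarrow> real \<Rightarrow> real \<Rightarrow> (real \<Rightarrow> real \<Rightarrow> real \<Rightarrow> real) \<Rightarrow> (real \<Rightarrow> real \<Rightarrow> real \<Rightarrow> real) \<Rightarrow> bool" where
  "approximate_treatment X A k V1 V2 \<longleftrightarrow>
     (let U = quadratic_in_q (\<lambda>_ _ _. 0) V1 V2; arr = arrival_linear A k U; T = horizon X in
      \<forall>(i, Vi)\<in>{(1, V1), (2, V2)}.
        C122 T Vi \<and>
        (\<forall>s. \<forall>v>0. \<forall>t\<in>{0<..<T}. q_coeff (\<lambda>q. hjb_lhs X arr U s v q t) i = 0) \<and>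
        (\<forall>s. \<forall>v\<ge>0. Vi s v T = 0) \<and>
        (\<forall>t\<in>{0..T}. \<forall>s. \<forall>v\<ge>0.
           Vi s v t = feynman_kac X (\<lambda>s v t. q_coeff (\<lambda>q. hjb_source X arr s v q t) i) s v t))"

end

(*
  The arrival term linearised at a quadratic function of q has no q-dependence, so V1 has zero source
  and V2 is the Feynman-Kac integral of the vega risk; this gives the premiums and identifies the
  approximate value with the inactive one.

  The inactive trader is not admissible, because exponential intensities never vanish. For V >= Vt it
  is approached by quoting the constant premium n: the orders then arrive at rate A exp (- k n), the
  premium income is nonnegative, and the running risk is at most xi^2 (|q| + Na + Nb)^2 times the
  vega risk. The latter is determined by the market filtration, hence independent of the clocks, which
  makes the bound integrable. As n grows the orders disappear and dominated convergence yields
  the inactive value as a lower bound for V.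
*)
theory Submission
  imports Defs
begin

subsection \<open>Counting paths and Poisson clocks\<close>

text \<open>Sampling the path at the next grid point gives a function that is jointly measurable,
  since only countably many times occur. Refining the grid recovers the path by right
  continuity.\<close>

lemma measurable_right_continuous_process:
  fixes f :: "real \<Rightarrow> 'w \<Rightarrow> real"
  assumes meas: "\<And>u. f u \<in> borel_measurable M"
    and rc: "\<And>u \<omega>. \<omega> \<in> space M \<Longrightarrow> continuous (at_right u) (\<lambda>r. f r \<omega>)"
  shows "(\<lambda>(u, \<omega>). f u \<omega>) \<in> borel_measurable (borel \<Otimes>\<^sub>M M)"
proof -
  \<comment> \<open>The first point of the grid with mesh \<open>1 / Suc n\<close> strictly to the
    right of \<open>x\<close>. Strictness matters: \<open>at_right x\<close> excludes
    \<open>x\<close> itself.\<close>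
  define a where "a n x = (real_of_int \<lfloor>real (Suc n) * x\<rfloor> + 1) / real (Suc n)" for n and x :: real
  have a_gt: "x < a n x" and a_le: "a n x \<le> x + 1 / real (Suc n)" for n x
  proof -
    have "real (Suc n) * x < real_of_int \<lfloor>real (Suc n) * x\<rfloor> + 1" by linarith
    then show "x < a n x" by (simp add: a_def field_simps del: of_nat_Suc)
    have "real_of_int \<lfloor>real (Suc n) * x\<rfloor> + 1 \<le> real (Suc n) * x + 1" by linarith
    then have "a n x \<le> (real (Suc n) * x + 1) / real (Suc n)"
      unfolding a_def by (rule divide_right_mono) simp
    then show "a n x \<le> x + 1 / real (Suc n)" by (simp add: add_divide_distrib del: of_nat_Suc)
  qed
  have a_lim: "filterlim (\<lambda>n. a n x) (at_right x) sequentially" for x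
  proof -
    have "(\<lambda>n. x + 1 / real (Suc n)) \<longlonglongrightarrow> x + 0"
      by (intro tendsto_add tendsto_const LIMSEQ_Suc[OF lim_1_over_n])
    then have up: "(\<lambda>n. x + 1 / real (Suc n)) \<longlonglongrightarrow> x" by simp
    have "(\<lambda>n. a n x) \<longlonglongrightarrow> x"
      by (rule tendsto_sandwich[OF _ _ tendsto_const up])
         (use a_gt[of x] a_le[where x=x] in \<open>simp_all add: less_imp_le del: of_nat_Suc\<close>)
    then show ?thesis
      using a_gt[of x] by (simp add: filterlim_at order_less_imp_not_eq2)
  qed
  define g where "g n z = f (a n (fst z)) (snd z)" for n and z :: "real \<times> 'w"
  have "g n \<in> borel_measurable (borel \<Otimes>\<^sub>M M)" for n
    unfolding g_def a_def
    by (rule measurable_compose_countable'[where I="UNIV :: int set"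
          and f="\<lambda>i z. f ((real_of_int i + 1) / real (Suc n)) (snd z)"])
       (auto intro!: measurable_compose[OF measurable_snd meas])
  moreover have "(\<lambda>n. g n z) \<longlonglongrightarrow> (case z of (u, \<omega>) \<Rightarrow> f u \<omega>)" if "z \<in> space (borel \<Otimes>\<^sub>M M)" for z
  proof -
    have "snd z \<in> space M" using that by (auto simp: space_pair_measure)
    from rc[OF this, of "fst z"] have "((\<lambda>r. f r (snd z)) \<longlongrightarrow> f (fst z) (snd z)) (at_right (fst z))"
      by (simp add: continuous_within)
    from filterlim_compose[OF this a_lim] show ?thesis
      by (simp add: g_def case_prod_beta)
  qed
  ultimately show ?thesis
    by (rule borel_measurable_LIMSEQ_metric)
qed

lemma Lim_at_left_eq:
  fixes N :: "real \<Rightarrow> nat"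
  assumes "r < u" "\<And>x. r \<le> x \<Longrightarrow> x < u \<Longrightarrow> N x = m"
  shows "Lim (at_left u) N = m"
proof (rule tendsto_Lim)
  have "eventually (\<lambda>x. N x = m) (at_left u)"
    unfolding eventually_at_left_field using assms by (meson less_imp_le)
  then show "(N \<longlongrightarrow> m) (at_left u)" by (rule tendsto_eventually)
qed simp

text \<open>Only finitely many values occur on \<open>{a..<u}\<close>, all being at most
  \<open>N b\<close>. Once the largest of them is reached, monotonicity freezes the path until
  \<open>u\<close>, so left limits exist.\<close>

lemma mono_nat_constant_left:
  fixes N :: "real \<Rightarrow> nat"
  assumes mono: "mono_on {a..b} N" and u: "a < u" "u \<le> b"
  obtains r where "a \<le> r" "r < u" "\<And>x. r \<le> x \<Longrightarrow> x < u \<Longrightarrow> N x = N r"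
proof -
  have fin: "finite (N ` {a..<u})"
    by (rule finite_subset[of _ "{..N b}"]) (use u in \<open>auto intro!: mono_onD[OF mono]\<close>)
  have "Max (N ` {a..<u}) \<in> N ` {a..<u}"
    using u by (intro Max_in fin) auto
  then obtain r where r: "r \<in> {a..<u}" "N r = Max (N ` {a..<u})" by auto
  show thesis
  proof
    fix x assume x: "r \<le> x" "x < u"
    then have "N x \<le> N r" using r by (auto intro!: Max_ge fin)
    moreover have "N r \<le> N x" using x r u by (intro mono_onD[OF mono]) auto
    ultimately show "N x = N r" by simp
  qed (use r in auto)
qed

lemma sum_jumps:
  fixes N :: "real \<Rightarrow> nat"
  assumes "a \<le> b" "mono_on {a..b} N" "\<And>u. u \<in> {a..<b} \<Longrightarrow> continuous (at_right u) N"
  defines "J \<equiv> \<lambda>b. {u. u \<in> {a<..b} \<and> N u \<noteq> Lim (at_left u) N}"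
  shows "finite (J b) \<and>
    (\<Sum>u\<in>J b. real (N u) - real (Lim (at_left u) N)) = real (N b) - real (N a)"
  using assms(1-3)
proof (induction "N b - N a" arbitrary: b rule: less_induct)
  case less
  note mono = less.prems(2)
  show ?case
  proof (cases "N b = N a")
    case True
    then have eq: "N x = N a" if "x \<in> {a..b}" for x
      using mono_onD[OF mono, of a x] mono_onD[OF mono, of x b] that by auto
    have "Lim (at_left u) N = N u" if "u \<in> {a<..b}" for u
    proof (rule Lim_at_left_eq[of a])
      fix x assume "a \<le> x" "x < u"
      then show "N x = N u" using eq[of x] eq[of u] that by simp
    qed (use that in simp)
    then have "J b = {}" by (auto simp: J_def)
    then show ?thesis using True by simp
  next
    case False
    \<comment> \<open>The times at which the final value is already attained; their infimum
      \<open>\<tau>\<close> is the last jump time.\<close>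
    define E where "E = {u \<in> {a..b}. N u = N b}"
    define \<tau> where "\<tau> = Inf E"
    have bE: "b \<in> E" using less.prems(1) by (auto simp: E_def)
    have bdd: "bdd_below E" by (auto simp: E_def)
    have tau: "\<tau> \<in> {a..b}"
    proof -
      have "\<tau> \<le> b" unfolding \<tau>_def by (rule cInf_lower[OF bE bdd])
      moreover have "a \<le> \<tau>" unfolding \<tau>_def using bE by (intro cInf_greatest) (auto simp: E_def)
      ultimately show ?thesis by simp
    qed
    have upper: "N x = N b" if "\<tau> < x" "x \<le> b" for x
    proof -
      have "Inf E < x" "E \<noteq> {}" using that bE by (auto simp: \<tau>_def)
      from cInf_lessD[OF this(2,1)] obtain y where "y \<in> E" "y < x" by (elim bexE)
      then show ?thesis
        using mono_onD[OF mono, of y x] mono_onD[OF mono, of x b] that tau by (auto simp: E_def)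
    qed
    \<comment> \<open>The infimum is attained: just to the right of \<open>\<tau>\<close> the path
      equals \<open>N b\<close> by \<open>upper\<close> and equals \<open>N \<tau>\<close> by right
      continuity, integer values making convergence eventual equality.\<close>
    have N\<tau>: "N \<tau> = N b"
    proof (cases "\<tau> = b")
      case False
      then have "continuous (at_right \<tau>) N" using less.prems(3) tau by auto
      then have "eventually (\<lambda>x. N x = N \<tau>) (at_right \<tau>)"
        by (simp add: continuous_within tendsto_discrete)
      then obtain d where d: "\<tau> < d" "\<And>x. \<tau> < x \<Longrightarrow> x < d \<Longrightarrow> N x = N \<tau>"
        unfolding eventually_at_right_field by blast
      obtain x where "\<tau> < x" "x < min d b"
        using dense[of \<tau> "min d b"] d False tau by auto
      then show ?thesis using d(2)[of x] upper[of x] by auto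
    qed simp
    have "a < \<tau>" using N\<tau> False tau by (cases "\<tau> = a") auto
    then obtain r where r: "a \<le> r" "r < \<tau>" "\<And>x. r \<le> x \<Longrightarrow> x < \<tau> \<Longrightarrow> N x = N r"
      using mono_nat_constant_left[OF mono, of \<tau>] tau by auto
    \<comment> \<open>As \<open>r\<close> lies before the infimum of \<open>E\<close>, the final
      value is not yet reached there, so the increase up to \<open>r\<close> is strictly smaller and
      the induction hypothesis applies on \<open>{a..r}\<close>.\<close>
    have "r \<notin> E" using r(2) cInf_lower[OF _ bdd, of r] unfolding \<tau>_def by linarith
    then have "N r \<noteq> N b" using r(1,2) tau by (auto simp: E_def)
    moreover have Nr: "N r \<le> N b" "N a \<le> N r"
      using r(1,2) tau by (auto intro!: mono_onD[OF mono])
    ultimately have lt: "N r < N b" by simp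
    then have "N r - N a < N b - N a" using Nr by simp
    moreover have "mono_on {a..r} N"
      using r(1,2) tau by (intro mono_on_subset[OF mono]) auto
    moreover have "continuous (at_right u) N" if "u \<in> {a..<r}" for u
      using that r(1,2) tau by (intro less.prems(3)) auto
    ultimately have IH: "finite (J r)"
      "(\<Sum>u\<in>J r. real (N u) - real (Lim (at_left u) N)) = real (N r) - real (N a)"
      using less.hyps[of r] r(1) by blast+
    have L\<tau>: "Lim (at_left \<tau>) N = N r" by (rule Lim_at_left_eq[OF r(2,3)])
    have L1: "Lim (at_left u) N = N u" if "r < u" "u < \<tau>" for u
    proof (rule Lim_at_left_eq[of r])
      fix x assume "r \<le> x" "x < u"
      then show "N x = N u" using r(3)[of x] r(3)[of u] that by simp
    qed (use that in simp)
    have L2: "Lim (at_left u) N = N u" if "\<tau> < u" "u \<le> b" for u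
    proof (rule Lim_at_left_eq[of \<tau>])
      fix x assume "\<tau> \<le> x" "x < u"
      then show "N x = N u" using upper[of x] upper[of u] N\<tau> that by (cases "x = \<tau>") auto
    qed (use that in simp)
    have "J b = insert \<tau> (J r)"
    proof (intro set_eqI iffI)
      fix u assume u: "u \<in> J b"
      then have "u \<le> r \<or> u = \<tau>" using L1[of u] L2[of u] unfolding J_def by force
      then show "u \<in> insert \<tau> (J r)" using u by (auto simp: J_def)
    next
      fix u assume "u \<in> insert \<tau> (J r)"
      then show "u \<in> J b" using L\<tau> lt N\<tau> \<open>a < \<tau>\<close> tau r(1,2) by (auto simp: J_def)
    qed
    moreover have "\<tau> \<notin> J r" using r(2) by (auto simp: J_def)
    ultimately show ?thesis using IH L\<tau> N\<tau> by simp
  qed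
qed

lemma jump_integral_const:
  fixes N :: "real \<Rightarrow> nat"
  assumes "t \<le> T" "mono_on {t..T} N" "\<And>u. u \<in> {t..<T} \<Longrightarrow> continuous (at_right u) N"
  shows "jump_integral t T (\<lambda>_. d) N = d * (real (N T) - real (N t))"
  unfolding jump_integral_def
  using sum_jumps[OF assms] by (simp add: sum_distrib_left[symmetric])

section \<open>Moments and path regularity of a Poisson clock\<close>

text \<open>The quadratic Taylor bound gives \<open>n^2 \<le> 2 * exp n\<close>, so the series is
  dominated by a multiple of the exponential series at \<open>exp 1 * r\<close>.\<close>

lemma summable_poisson_square: "summable (\<lambda>n. r ^ n / fact n * exp (-r) * (real n)\<^sup>2)" if "0 \<le> r"
proof (rule summable_comparison_test')
  have "summable (\<lambda>n. (exp 1 * r) ^ n /\<^sub>R fact n)"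
    by (rule summable_exp_generic)
  then show "summable (\<lambda>n. 2 * exp (-r) * ((exp 1 * r) ^ n /\<^sub>R fact n))"
    by (rule summable_mult)
  fix n :: nat
  have "(real n)\<^sup>2 \<le> 2 * exp (real n)"
    using exp_lower_Taylor_quadratic[of "real n"] by simp
  also have "exp (real n) = exp 1 ^ n" by (simp add: exp_of_nat_mult[symmetric])
  finally have "r ^ n / fact n * exp (-r) * (real n)\<^sup>2 \<le> r ^ n / fact n * exp (-r) * (2 * exp 1 ^ n)"
    using that by (intro mult_left_mono) auto
  then show "norm (r ^ n / fact n * exp (-r) * (real n)\<^sup>2) \<le> 2 * exp (-r) * ((exp 1 * r) ^ n /\<^sub>R fact n)"
    using that by (simp add: field_simps)
qed

lemma integrable_poisson_square:
  assumes "0 < r" shows "integrable (measure_pmf (poisson_pmf r)) (\<lambda>n. (real n)\<^sup>2)"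
proof -
  have "integrable (count_space UNIV) (\<lambda>n. pmf (poisson_pmf r) n *\<^sub>R (real n)\<^sup>2)"
    using summable_poisson_square[of r] assms
    by (simp add: integrable_count_space_nat_iff abs_mult)
  then show ?thesis
    unfolding measure_pmf_eq_density by (subst integrable_density) auto
qed

text \<open>For positive \<open>c\<close> the clock at \<open>c\<close> is its increment from time 0
  and so has a Poisson law. Time 0 is separate because increments are specified over nondegenerate
  intervals. The first moment follows from \<open>n \<le> n^2\<close> on naturals.\<close>

lemma
  assumes "standard_poisson M P" "0 \<le> c"
  shows standard_poisson_square_integrable: "integrable M (\<lambda>\<omega>. (real (P c \<omega>))\<^sup>2)"
    and standard_poisson_integrable: "integrable M (\<lambda>\<omega>. real (P c \<omega>))"
proof -
  have P0: "P 0 \<omega> = 0" if "\<omega> \<in> space M" for \<omega>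
    using assms that by (auto simp: standard_poisson_def)
  have meas[measurable]: "P c \<in> measurable M (count_space UNIV)" "P 0 \<in> measurable M (count_space UNIV)"
    using assms by (auto simp: standard_poisson_def)
  have sq: "integrable M (\<lambda>\<omega>. (real (P c \<omega>))\<^sup>2)"
  proof (cases "c = 0")
    case True
    have "integrable M (\<lambda>\<omega>. (real (P c \<omega>))\<^sup>2) \<longleftrightarrow> integrable M (\<lambda>\<omega>. 0 :: real)"
      by (rule Bochner_Integration.integrable_cong) (auto simp: True P0)
    then show ?thesis by simp
  next
    case False
    then have "distr M (count_space UNIV) (\<lambda>\<omega>. P c \<omega> - P 0 \<omega>) = measure_pmf (poisson_pmf (c - 0))"
      using assms unfolding standard_poisson_def by auto
    then have "integrable (distr M (count_space UNIV) (\<lambda>\<omega>. P c \<omega> - P 0 \<omega>)) (\<lambda>n. (real n)\<^sup>2)"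
      using integrable_poisson_square[of c] False assms(2) by simp
    then have "integrable M (\<lambda>\<omega>. (real (P c \<omega> - P 0 \<omega>))\<^sup>2)"
      by (subst (asm) integrable_distr_eq) auto
    moreover have "integrable M (\<lambda>\<omega>. (real (P c \<omega> - P 0 \<omega>))\<^sup>2) \<longleftrightarrow> integrable M (\<lambda>\<omega>. (real (P c \<omega>))\<^sup>2)"
      by (rule Bochner_Integration.integrable_cong) (auto simp: P0)
    ultimately show ?thesis by blast
  qed
  then show "integrable M (\<lambda>\<omega>. (real (P c \<omega>))\<^sup>2)" .
  from sq show "integrable M (\<lambda>\<omega>. real (P c \<omega>))"
  proof (rule Bochner_Integration.integrable_bound)
    have "real n \<le> (real n)\<^sup>2" for n
      by (cases n) (auto simp: power2_eq_square mult_le_cancel_right1)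
    then show "AE \<omega> in M. norm (real (P c \<omega>)) \<le> norm ((real (P c \<omega>))\<^sup>2)" by simp
  qed measurable
qed

text \<open>The map \<open>r \<mapsto> c * (r - t)\<close> is strictly increasing, so it carries
  right neighbourhoods to right neighbourhoods. Clamping at \<open>t\<close> makes the path constant
  earlier, which gives right continuity at every real time.\<close>

lemma standard_poisson_continuous_at_right:
  assumes "standard_poisson M P" "\<omega> \<in> space M" "0 < c"
  shows "continuous (at_right u) (\<lambda>r. P (c * (max t r - t)) \<omega>)"
proof -
  have main: "continuous (at_right u) (\<lambda>r. P (c * (r - t)) \<omega>)" if "t \<le> u" for u
  proof -
    have "((\<lambda>r. P r \<omega>) \<longlongrightarrow> P (c * (u - t)) \<omega>) (at_right (c * (u - t)))"
      using assms that by (auto simp: standard_poisson_def continuous_within)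
    moreover have "filterlim (\<lambda>r. c * (r - t)) (at_right (c * (u - t))) (at_right u)"
      unfolding filterlim_at
      using assms(3) by (auto intro!: tendsto_eq_intros simp: eventually_at_right_field intro: exI[of _ "u + 1"])
    ultimately show ?thesis
      unfolding continuous_within by (rule filterlim_compose)
  qed
  show "continuous (at_right u) (\<lambda>r. P (c * (max t r - t)) \<omega>)"
  proof (cases "t \<le> u")
    case True
    have "eventually (\<lambda>r. P (c * (r - t)) \<omega> = P (c * (max t r - t)) \<omega>) (at_right u)"
      using True by (auto simp: eventually_at_right_field max_def intro: exI[of _ "u + 1"])
    then show ?thesis
      using main[OF True] True unfolding continuous_within
      by (simp add: max_absorb2 tendsto_cong)
  next
    case False
    then have "eventually (\<lambda>r. P (c * (max t r - t)) \<omega> = P (c * (max t u - t)) \<omega>) (at_right u)"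
      by (auto simp: eventually_at_right_field max_def intro!: exI[of _ t])
    then show ?thesis
      unfolding continuous_within by (rule tendsto_eventually)
  qed
qed

section \<open>Auxiliary facts on independence and interval integrals\<close>

lemma (in prob_space) indep_set_imp_indep_var:
  fixes Z Y :: "'a \<Rightarrow> real"
  assumes "indep_set A B" "sigma_algebra (space M) A" "sigma_algebra (space M) B"
    and Z: "\<And>E. E \<in> sets borel \<Longrightarrow> Z -` E \<inter> space M \<in> A"
    and Y: "\<And>E. E \<in> sets borel \<Longrightarrow> Y -` E \<inter> space M \<in> B"
  shows "indep_var borel Z borel Y"
proof -
  have sub: "A \<subseteq> events" "B \<subseteq> events"
    using assms(1) unfolding indep_set_def indep_sets_def by (auto simp: UNIV_bool)
  have "sigma_sets (space M) {Z -` E \<inter> space M | E. E \<in> sets borel} \<subseteq> A"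
    by (intro sigma_algebra.sigma_sets_subset[OF assms(2)]) (auto intro: Z)
  moreover have "sigma_sets (space M) {Y -` E \<inter> space M | E. E \<in> sets borel} \<subseteq> B"
    by (intro sigma_algebra.sigma_sets_subset[OF assms(3)]) (auto intro: Y)
  ultimately have "indep_set (sigma_sets (space M) {Z -` E \<inter> space M | E. E \<in> sets borel})
      (sigma_sets (space M) {Y -` E \<inter> space M | E. E \<in> sets borel})"
    using assms(1) unfolding indep_set_def
    by (elim indep_sets_mono_sets) (auto split: bool.split)
  moreover have "random_variable borel Z" "random_variable borel Y"
    using Z Y sub by (auto intro!: measurableI)
  ultimately show ?thesis
    unfolding indep_var_eq by simp
qed

text \<open>Moves the interval into an indicator, so that measurability and domination can be argued
  for ordinary integrals over the whole line.\<close>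

lemma interval_integral_lborel_eq:
  fixes f :: "real \<Rightarrow> real"
  assumes "a \<le> b"
  shows "(LBINT u=a..b. f u) = (\<integral>u. indicator {a<..<b} u * f u \<partial>lborel)"
    and "interval_lebesgue_integrable lborel (ereal a) (ereal b) f \<longleftrightarrow>
      integrable lborel (\<lambda>u. indicator {a<..<b} u * f u)"
  using assms
  by (simp_all add: interval_lebesgue_integral_def interval_lebesgue_integrable_def
      set_lebesgue_integral_def set_integrable_def)

subsection \<open>Vega risk\<close>

definition vega_rate :: "'w dealer_model \<Rightarrow> real \<Rightarrow> real \<Rightarrow> real \<Rightarrow> real \<Rightarrow> 'w \<Rightarrow> real" where
  "vega_rate X t s v u \<omega> =
     vari X t s v u \<omega> * (d_v (call X) (stock X t s v u \<omega>) (vari X t s v u \<omega>) u)\<^sup>2"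

text \<open>Measurability is stated for the terminal market sigma-algebra
  \<open>filt X (horizon X)\<close>, because that is the one whose independence of the clocks is
  used later.\<close>

lemma heston_paths:
  assumes "heston_market X" "t \<in> {0..horizon X}" "0 \<le> v"
  shows "\<omega> \<in> space (pspace X) \<Longrightarrow> u \<in> {t..horizon X} \<Longrightarrow> 0 \<le> vari X t s v u \<omega>"
    and "\<omega> \<in> space (pspace X) \<Longrightarrow> continuous_on {t..horizon X} (\<lambda>u. stock X t s v u \<omega>)"
    and "\<omega> \<in> space (pspace X) \<Longrightarrow> continuous_on {t..horizon X} (\<lambda>u. vari X t s v u \<omega>)"
    and "u \<in> {t..horizon X} \<Longrightarrow> stock X t s v u \<in> borel_measurable (filt X (horizon X))"
    and "u \<in> {t..horizon X} \<Longrightarrow> vari X t s v u \<in> borel_measurable (filt X (horizon X))"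
    and "space (filt X (horizon X)) = space (pspace X)"
    and "sets (filt X (horizon X)) \<subseteq> sets (pspace X)"
proof -
  have sol: "heston_solution X t s v (stock X t s v) (vari X t s v)"
    and fil: "filtration (space (pspace X)) (filt X)"
    and sub: "subalgebra (pspace X) (filt X (horizon X))"
    using assms by (auto simp: heston_market_def)
  have lift: "f \<in> borel_measurable (filt X (horizon X))"
    if "f \<in> borel_measurable (filt X u)" "u \<le> horizon X" for f :: "_ \<Rightarrow> real" and u
  proof (rule measurable_from_subalg[OF _ that(1)])
    show "subalgebra (filt X (horizon X)) (filt X u)"
      using filtration.sets_F_mono[OF fil that(2)] filtration.space_F[OF fil]
      by (auto simp: subalgebra_def)
  qed
  show "\<omega> \<in> space (pspace X) \<Longrightarrow> u \<in> {t..horizon X} \<Longrightarrow> 0 \<le> vari X t s v u \<omega>"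
    "\<omega> \<in> space (pspace X) \<Longrightarrow> continuous_on {t..horizon X} (\<lambda>u. stock X t s v u \<omega>)"
    "\<omega> \<in> space (pspace X) \<Longrightarrow> continuous_on {t..horizon X} (\<lambda>u. vari X t s v u \<omega>)"
    using sol by (auto simp: heston_solution_def Let_def)
  show "u \<in> {t..horizon X} \<Longrightarrow> stock X t s v u \<in> borel_measurable (filt X (horizon X))"
    "u \<in> {t..horizon X} \<Longrightarrow> vari X t s v u \<in> borel_measurable (filt X (horizon X))"
    using sol by (auto simp: heston_solution_def Let_def intro: lift)
  show "space (filt X (horizon X)) = space (pspace X)"
    "sets (filt X (horizon X)) \<subseteq> sets (pspace X)"
    using sub by (auto simp: subalgebra_def)
qed

lemma vega_rate_nonneg:
  assumes "heston_market X" "t \<in> {0..horizon X}" "0 \<le> v"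
    "\<omega> \<in> space (pspace X)" "u \<in> {t..horizon X}"
  shows "0 \<le> vega_rate X t s v u \<omega>"
  using heston_paths(1)[OF assms] by (simp add: vega_rate_def)

text \<open>The process is controlled only on \<open>{t..T}\<close>. Clamping time to this interval
  extends its paths continuously to the whole line.\<close>

lemma measurable_clamped_process:
  fixes f :: "real \<Rightarrow> 'w \<Rightarrow> real"
  assumes "t \<le> T" "\<And>u. u \<in> {t..T} \<Longrightarrow> f u \<in> borel_measurable M"
    and cont: "\<And>\<omega>. \<omega> \<in> space M \<Longrightarrow> continuous_on {t..T} (\<lambda>u. f u \<omega>)"
  shows "(\<lambda>(u, \<omega>). f (max t (min u T)) \<omega>) \<in> borel_measurable (borel \<Otimes>\<^sub>M M)"
proof (rule measurable_right_continuous_process)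
  show "f (max t (min u T)) \<in> borel_measurable M" for u
    using assms(1) by (intro assms(2)) auto
  fix u \<omega> assume "\<omega> \<in> space M"
  then have "continuous_on UNIV (\<lambda>u. f (max t (min u T)) \<omega>)"
    using assms(1) by (intro continuous_on_compose2[OF cont]) (auto intro!: continuous_intros)
  then have "isCont (\<lambda>u. f (max t (min u T)) \<omega>) u"
    by (simp add: continuous_on_eq_continuous_at)
  then show "continuous (at_right u) (\<lambda>u. f (max t (min u T)) \<omega>)"
    by (rule continuous_at_imp_continuous_at_within)
qed

text \<open>Regularity of \<open>call X\<close> controls its vega only for positive variance and
  times strictly inside the horizon. The open indicator handles the time boundary and the factor
  \<open>vari\<close> handles zero variance.\<close>

lemma measurable_vega_rate:
  assumes market: "heston_market X" and C: "C122 (horizon X) (call X)"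
    and tv: "t \<in> {0..horizon X}" "0 \<le> v"
  shows "(\<lambda>(u, \<omega>). indicator {t<..<horizon X} u * vega_rate X t s v u \<omega>)
    \<in> borel_measurable (borel \<Otimes>\<^sub>M filt X (horizon X))"
proof -
  define T where "T = horizon X"
  note paths = heston_paths[OF market tv, folded T_def]
  define D :: "(real \<times> real \<times> real) set" where "D = UNIV \<times> {0<..} \<times> {0<..<T}"
  \<comment> \<open>The vega cut off to the open region \<open>D\<close> where it is continuous.
    Outside, \<open>deriv\<close> may take arbitrary values, but \<open>g\<close> is Borel
    everywhere.\<close>
  define g where "g z = indicator D z *\<^sub>R (case z of (s, v, t) \<Rightarrow> d_v (call X) s v t)" for z
  have "open D" unfolding D_def by (intro open_Times) auto
  have "continuous_on D (\<lambda>(s, v, t). d_v (call X) s v t)"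
    using C by (auto simp: C122_def D_def T_def)
  then have g[measurable]: "g \<in> borel_measurable borel"
    unfolding g_def using \<open>open D\<close> by (intro borel_measurable_continuous_on_indicator) auto
  define S where "S z = stock X t s v (max t (min (fst z) T)) (snd z)" for z
  define N where "N z = vari X t s v (max t (min (fst z) T)) (snd z)" for z
  have [measurable]: "S \<in> borel_measurable (borel \<Otimes>\<^sub>M filt X T)"
    using measurable_clamped_process[of t T "stock X t s v" "filt X T"] tv paths(2,4,6)
    by (simp add: S_def[abs_def] case_prod_beta' T_def)
  have [measurable]: "N \<in> borel_measurable (borel \<Otimes>\<^sub>M filt X T)"
    using measurable_clamped_process[of t T "vari X t s v" "filt X T"] tv paths(3,5,6)
    by (simp add: N_def[abs_def] case_prod_beta' T_def)
  have "(\<lambda>z. g (S z, N z, fst z)) \<in> borel_measurable (borel \<Otimes>\<^sub>M filt X T)"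
    by (intro measurable_compose[OF _ g] borel_measurable_Pair) auto
  then have "(\<lambda>z. indicator {t<..<T} (fst z) * (N z * (g (S z, N z, fst z))\<^sup>2))
      \<in> borel_measurable (borel \<Otimes>\<^sub>M filt X T)"
    by (intro borel_measurable_times borel_measurable_power
        measurable_compose[OF measurable_fst borel_measurable_indicator]) auto
  moreover have "indicator {t<..<T} (fst z) * (N z * (g (S z, N z, fst z))\<^sup>2) =
      indicator {t<..<T} (fst z) * vega_rate X t s v (fst z) (snd z)"
    if "z \<in> space (borel \<Otimes>\<^sub>M filt X T)" for z
  proof (cases "fst z \<in> {t<..<T}")
    case True
    have clamp: "max t (min (fst z) T) = fst z" using True by auto
    have SN: "S z = stock X t s v (fst z) (snd z)" "N z = vari X t s v (fst z) (snd z)"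
      unfolding S_def N_def clamp by auto
    have "snd z \<in> space (pspace X)" using measurable_space[OF measurable_snd that] paths(6) by simp
    then have "0 \<le> vari X t s v (fst z) (snd z)" using True by (intro paths(1)) auto
    moreover have "0 < fst z" "fst z < T" using True tv by auto
    \<comment> \<open>At zero variance the point lies outside \<open>D\<close>, but the factor
      \<open>N z\<close> makes both sides vanish.\<close>
    ultimately show ?thesis
      by (cases "vari X t s v (fst z) (snd z) = 0")
         (simp_all add: vega_rate_def SN g_def D_def)
  qed simp
  ultimately show ?thesis
    unfolding T_def[symmetric] case_prod_beta' by (subst (asm) measurable_cong) simp_all
qed

lemma vega_risk_eq:
  assumes "t \<in> {0..horizon X}"
  shows "vega_risk X s v t \<omega> = (\<integral>u. indicator {t<..<horizon X} u * vega_rate X t s v u \<omega> \<partial>lborel)"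
  using assms by (simp add: vega_risk_def vega_rate_def interval_integral_lborel_eq)

lemma vega_risk_measurable:
  assumes "heston_market X" "C122 (horizon X) (call X)" "t \<in> {0..horizon X}" "0 \<le> v"
  shows "vega_risk X s v t \<in> borel_measurable (filt X (horizon X))"
proof -
  have "(\<lambda>(\<omega>, u). indicator {t<..<horizon X} u * vega_rate X t s v u \<omega>)
      \<in> borel_measurable (filt X (horizon X) \<Otimes>\<^sub>M lborel)"
    using measurable_pair_swap[OF measurable_vega_rate[OF assms, of s]]
    by (simp add: case_prod_beta')
  then show ?thesis
    unfolding vega_risk_eq[OF assms(3), abs_def]
    by (rule lborel.borel_measurable_lebesgue_integral)
qed

lemma vega_risk_nonneg:
  assumes "heston_market X" "t \<in> {0..horizon X}" "0 \<le> v" "\<omega> \<in> space (pspace X)"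
  shows "0 \<le> vega_risk X s v t \<omega>"
  unfolding vega_risk_eq[OF assms(2)]
  using vega_rate_nonneg[OF assms] by (intro integral_nonneg_AE) (auto simp: indicator_def)

section \<open>Independence of the market from each clock\<close>

lemma (in prob_space) indep_sets_imp_indep_set:
  assumes "indep_sets F I" "i \<in> I" "j \<in> I" "i \<noteq> j"
  shows "indep_set (F i) (F j)"
  unfolding indep_sets2_eq
proof (intro conjI ballI)
  show "F i \<subseteq> events" "F j \<subseteq> events"
    using assms by (auto simp: indep_sets_def)
  fix a b assume "a \<in> F i" "b \<in> F j"
  then have "prob (\<Inter>l\<in>{i, j}. if l = i then a else b) = (\<Prod>l\<in>{i, j}. prob (if l = i then a else b))"
    using assms by (intro indep_setsD[OF assms(1)]) auto
  then show "prob (a \<inter> b) = prob a * prob b"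
    using assms(4) by (simp add: Int_commute split: if_splits)
qed

lemma order_clocks_indep:
  assumes "order_clocks X" "prob_space (pspace X)" "0 \<le> T"
  shows "prob_space.indep_set (pspace X) (sets (filt X T)) (process_sigma (pspace X) (clock_a X))"
    and "prob_space.indep_set (pspace X) (sets (filt X T)) (process_sigma (pspace X) (clock_b X))"
proof -
  interpret prob_space "pspace X" by fact
  have *: "indep_sets (\<lambda>i. [sets (filt X T), process_sigma (pspace X) (clock_a X),
      process_sigma (pspace X) (clock_b X)] ! i) {..<3::nat}"
    using assms by (auto simp: order_clocks_def)
  show "indep_set (sets (filt X T)) (process_sigma (pspace X) (clock_a X))"
    using indep_sets_imp_indep_set[OF *, of 0 1] by simp
  show "indep_set (sets (filt X T)) (process_sigma (pspace X) (clock_b X))"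
    using indep_sets_imp_indep_set[OF *, of 0 2] by simp
qed

text \<open>A product of two independent integrable variables is integrable. This requires of
  \<open>Z\<close> no moment beyond the first.\<close>

lemma (in prob_space) indep_poisson_square_integrable:
  assumes F: "space F = space M" "indep_set (sets F) (process_sigma M P)"
    and Z: "Z \<in> borel_measurable F" "integrable M Z"
    and P: "standard_poisson M P" "0 \<le> c"
  shows "integrable M (\<lambda>\<omega>. Z \<omega> * (real (P c \<omega>))\<^sup>2)"
proof (rule indep_var_integrable[OF _ Z(2) standard_poisson_square_integrable[OF P]])
  show "indep_var borel Z borel (\<lambda>\<omega>. (real (P c \<omega>))\<^sup>2)"
  proof (rule indep_set_imp_indep_var[OF F(2)])
    show "sigma_algebra (space M) (sets F)"
      using sets.sigma_algebra_axioms[of F] F(1) by simp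
    show "sigma_algebra (space M) (process_sigma M P)"
      unfolding process_sigma_def by (rule sigma_algebra_sigma_sets) auto
    show "Z -` E \<inter> space M \<in> sets F" if "E \<in> sets borel" for E
      using measurable_sets[OF Z(1) that] F(1) by simp
    \<comment> \<open>Every set of naturals has its preimage among the generators of
      \<open>process_sigma\<close>, so the set of those \<open>n\<close> whose square lies in
      \<open>E\<close> can be used directly.\<close>
    show "(\<lambda>\<omega>. (real (P c \<omega>))\<^sup>2) -` E \<inter> space M \<in> process_sigma M P" for E
    proof -
      have "(\<lambda>\<omega>. (real (P c \<omega>))\<^sup>2) -` E \<inter> space M = P c -` {n. (real n)\<^sup>2 \<in> E} \<inter> space M" by auto
      then have "(\<lambda>\<omega>. (real (P c \<omega>))\<^sup>2) -` E \<inter> space M \<in> {P u -` A \<inter> space M | u A. 0 \<le> u}"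
        using P(2) by blast
      then show ?thesis
        unfolding process_sigma_def by (rule sigma_sets.Basic)
    qed
  qed
qed

subsection \<open>Constant premiums\<close>

text \<open>The count of orders arriving at constant rate \<open>c\<close> from time
  \<open>t\<close> on. The clamp keeps the clock argument nonnegative and the count frozen before
  \<open>t\<close>, so joint measurability can be shown over all real times.\<close>

definition clock_flow :: "(real \<Rightarrow> 'w \<Rightarrow> nat) \<Rightarrow> real \<Rightarrow> real \<Rightarrow> real \<Rightarrow> 'w \<Rightarrow> nat" where
  "clock_flow P c t u \<omega> = P (c * (max t u - t)) \<omega>"

lemma
  assumes P: "standard_poisson M P" and c: "0 < c"
  shows measurable_clock_flow: "clock_flow P c t u \<in> measurable M (count_space UNIV)"
    and clock_flow_start: "\<omega> \<in> space M \<Longrightarrow> clock_flow P c t t \<omega> = 0"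
    and clock_flow_mono: "\<omega> \<in> space M \<Longrightarrow> mono (\<lambda>u. clock_flow P c t u \<omega>)"
    and clock_flow_right_continuous: "\<omega> \<in> space M \<Longrightarrow> continuous (at_right u) (\<lambda>u. clock_flow P c t u \<omega>)"
    and measurable_clock_flow_pair:
      "(\<lambda>(u, \<omega>). real (clock_flow P c t u \<omega>)) \<in> borel_measurable (borel \<Otimes>\<^sub>M M)"
proof -
  have m: "clock_flow P c t u \<in> measurable M (count_space UNIV)" for u
    using P c by (auto simp: standard_poisson_def clock_flow_def[abs_def])
  then show "clock_flow P c t u \<in> measurable M (count_space UNIV)" .
  show "\<omega> \<in> space M \<Longrightarrow> clock_flow P c t t \<omega> = 0"
    using P by (auto simp: standard_poisson_def clock_flow_def)
  show "mono (\<lambda>u. clock_flow P c t u \<omega>)" if "\<omega> \<in> space M"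
  proof (rule monoI)
    fix x y :: real assume "x \<le> y"
    then have "c * (max t x - t) \<le> c * (max t y - t)" using c by (intro mult_left_mono) auto
    moreover have "mono_on {0..} (\<lambda>u. P u \<omega>)" using P that by (auto simp: standard_poisson_def)
    ultimately show "clock_flow P c t x \<omega> \<le> clock_flow P c t y \<omega>"
      unfolding clock_flow_def using c by (intro mono_onD[of "{0..}" "\<lambda>u. P u \<omega>"]) auto
  qed
  show rc: "continuous (at_right u) (\<lambda>u. clock_flow P c t u \<omega>)" if "\<omega> \<in> space M" for u \<omega>
    unfolding clock_flow_def by (rule standard_poisson_continuous_at_right[OF P that c])
  show "(\<lambda>(u, \<omega>). real (clock_flow P c t u \<omega>)) \<in> borel_measurable (borel \<Otimes>\<^sub>M M)"
  proof (rule measurable_right_continuous_process)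
    show "(\<lambda>\<omega>. real (clock_flow P c t u \<omega>)) \<in> borel_measurable M" for u
      by (rule measurable_compose[OF m]) simp
    show "continuous (at_right u) (\<lambda>r. real (clock_flow P c t r \<omega>))" if "\<omega> \<in> space M" for u \<omega>
      using rc[OF that, of u] unfolding continuous_within tendsto_discrete
      by (intro tendsto_eventually) (auto elim: eventually_mono)
  qed
qed

lemma jump_integral_clock_flow:
  assumes "standard_poisson M P" "0 < c" "\<omega> \<in> space M" "t \<le> T"
  shows "jump_integral t T (\<lambda>_. d) (\<lambda>u. clock_flow P c t u \<omega>) = d * real (clock_flow P c t T \<omega>)"
proof -
  have "mono_on {t..T} (\<lambda>u. clock_flow P c t u \<omega>)"
    using clock_flow_mono[OF assms(1-3)] by (auto simp: mono_on_def mono_def)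
  then show ?thesis
    using assms by (simp add: jump_integral_const clock_flow_right_continuous clock_flow_start)
qed

text \<open>Supplies the integrable majorant of the running risk, with \<open>a\<close> to be the
  absolute initial inventory. Vega risk is measurable for the market sigma-algebra, hence
  independent of each clock.\<close>

lemma vega_risk_clock_integrable:
  assumes "heston_market X" "order_clocks X" "C122 (horizon X) (call X)" "vega_risk_finite X"
    "t \<in> {0..horizon X}" "0 \<le> v" "0 \<le> c"
  shows "integrable (pspace X)
    (\<lambda>\<omega>. vega_risk X s v t \<omega> * (a + real (clock_a X c \<omega>) + real (clock_b X c \<omega>))\<^sup>2)"
proof -
  interpret prob_space "pspace X" using assms(1) by (simp add: heston_market_def)
  let ?Z = "vega_risk X s v t"
  note Z = vega_risk_measurable[OF assms(1,3,5,6), of s]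
  have intZ[simp]: "integrable (pspace X) ?Z"
    using assms by (auto simp: vega_risk_finite_def)
  have P: "standard_poisson (pspace X) (clock_a X)" "standard_poisson (pspace X) (clock_b X)"
    using assms(2) by (auto simp: order_clocks_def)
  have [measurable]: "clock_a X c \<in> measurable (pspace X) (count_space UNIV)"
    "clock_b X c \<in> measurable (pspace X) (count_space UNIV)"
    using P assms(7) by (auto simp: standard_poisson_def)
  have [measurable]: "?Z \<in> borel_measurable (pspace X)" using intZ by (rule borel_measurable_integrable)
  note ind = order_clocks_indep[OF assms(2) prob_space_axioms, of "horizon X"]
  note sp = heston_paths(6)[OF assms(1,5,6)]
  have "integrable (pspace X) (\<lambda>\<omega>. ?Z \<omega> * (real (clock_a X c \<omega>))\<^sup>2)"
    "integrable (pspace X) (\<lambda>\<omega>. ?Z \<omega> * (real (clock_b X c \<omega>))\<^sup>2)"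
    using ind assms(5) by (auto intro!: indep_poisson_square_integrable[OF sp _ Z intZ _ assms(7)] P)
  then have "integrable (pspace X) (\<lambda>\<omega>. 3 * (?Z \<omega> * a\<^sup>2 + ?Z \<omega> * (real (clock_a X c \<omega>))\<^sup>2
      + ?Z \<omega> * (real (clock_b X c \<omega>))\<^sup>2))" by simp
  then show ?thesis
  proof (rule Bochner_Integration.integrable_bound)
    \<comment> \<open>The difference of the two sides is the sum of the squares of
      \<open>a - x\<close>, \<open>x - y\<close> and \<open>a - y\<close>. The bound has no mixed
      terms, so each clock can be paired with the vega risk separately.\<close>
    have sq: "(a + x + y)\<^sup>2 \<le> 3 * (a\<^sup>2 + x\<^sup>2 + y\<^sup>2)" for x y :: real
      using sum_squares_ge_zero[of "a - x" "x - y"] zero_le_power2[of "a - y"]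
      by (simp add: power2_eq_square algebra_simps)
    have "norm (?Z \<omega> * (a + real (clock_a X c \<omega>) + real (clock_b X c \<omega>))\<^sup>2)
        \<le> norm (3 * (?Z \<omega> * a\<^sup>2 + ?Z \<omega> * (real (clock_a X c \<omega>))\<^sup>2 + ?Z \<omega> * (real (clock_b X c \<omega>))\<^sup>2))"
      if "\<omega> \<in> space (pspace X)" for \<omega>
    proof -
      have "0 \<le> ?Z \<omega>" using assms that by (intro vega_risk_nonneg)
      then have "?Z \<omega> * (a + real (clock_a X c \<omega>) + real (clock_b X c \<omega>))\<^sup>2
          \<le> ?Z \<omega> * (3 * (a\<^sup>2 + (real (clock_a X c \<omega>))\<^sup>2 + (real (clock_b X c \<omega>))\<^sup>2))"
        by (intro mult_left_mono sq)
      with \<open>0 \<le> ?Z \<omega>\<close> show ?thesis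
        by (simp add: distrib_left mult.left_commute)
    qed
    then show "AE \<omega> in pspace X. norm (?Z \<omega> * (a + real (clock_a X c \<omega>) + real (clock_b X c \<omega>))\<^sup>2)
        \<le> norm (3 * (?Z \<omega> * a\<^sup>2 + ?Z \<omega> * (real (clock_a X c \<omega>))\<^sup>2 + ?Z \<omega> * (real (clock_b X c \<omega>))\<^sup>2))"
      by (rule AE_I2)
  qed measurable
qed

text \<open>A constant premium makes the arrival rate constant, so the flow is explicit. The gain is
  only estimated from below: the income is nonnegative, and the inventory never exceeds in size
  \<open>\<bar>q\<bar>\<close> plus all orders of the period.\<close>

lemma constant_premium_gain:
  fixes X :: "'w dealer_model" and q :: int
  assumes market: "heston_market X" "order_clocks X" and C: "C122 (horizon X) (call X)"
    and hedged: "delta_hedged X" and finite: "vega_risk_finite X"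
    and tv: "t \<in> {0..horizon X}" "0 \<le> v"
    and lam: "lam_a X d = c" "lam_b X d = c" "0 < c" "0 \<le> d"
  defines "Na \<equiv> clock_flow (clock_a X) c t" and "Nb \<equiv> clock_flow (clock_b X) c t"
  shows "admissible X (\<lambda>_ _ _ _. d) (\<lambda>_ _ _ _. d) t s v q Na Nb" (is ?adm)
    and "- (gam X / 2) * (xi X)\<^sup>2 * (LINT \<omega>|pspace X. vega_risk X s v t \<omega> *
        (\<bar>real_of_int q\<bar> + real (clock_a X (c * (horizon X - t)) \<omega>)
          + real (clock_b X (c * (horizon X - t)) \<omega>))\<^sup>2)
      \<le> expected_gain X (\<lambda>_ _ _ _. d) (\<lambda>_ _ _ _. d) t s v q Na Nb" (is ?gain)
proof -
  let ?M = "pspace X" and ?T = "horizon X"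
  let ?Z = "vega_risk X s v t"
  have tT: "t \<le> ?T" "0 \<le> t" using tv by auto
  have P: "standard_poisson ?M (clock_a X)" "standard_poisson ?M (clock_b X)"
    using market(2) by (auto simp: order_clocks_def)
  have NaT: "Na ?T = clock_a X (c * (?T - t))" "Nb ?T = clock_b X (c * (?T - t))"
    using tT by (auto simp: Na_def Nb_def clock_flow_def)
  have cT: "0 \<le> c * (?T - t)" using tT lam by simp
  note flow = measurable_clock_flow[OF P(1) lam(3), of t, folded Na_def]
    measurable_clock_flow[OF P(2) lam(3), of t, folded Nb_def]
  have prem: "premium X (\<lambda>_ _ _ _. d) t s v q Na Nb u \<omega> = d" for u \<omega>
    by (simp add: premium_def)
  \<comment> \<open>In general the rates depend on the counts through the inventory, so
    \<open>order_flow\<close> is a fixed-point condition. Here the integrated rate is simply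
    \<open>c * (u - t)\<close>.\<close>
  have of: "order_flow X (\<lambda>_ _ _ _. d) (\<lambda>_ _ _ _. d) t s v q Na Nb"
    unfolding order_flow_def Let_def prem lam(1,2)
    using flow by (auto simp: Na_def Nb_def clock_flow_def mult.commute max_absorb2
        interval_integral_lborel_eq(2) tT)
  have income: "premium_income X (\<lambda>_ _ _ _. d) (\<lambda>_ _ _ _. d) t s v q Na Nb \<omega> =
      d * real (Na ?T \<omega>) + d * real (Nb ?T \<omega>)" if "\<omega> \<in> space ?M" for \<omega>
    unfolding premium_income_def prem
    using jump_integral_clock_flow[OF P(1) lam(3) that tT(1), of d]
      jump_integral_clock_flow[OF P(2) lam(3) that tT(1), of d]
    by (simp add: Na_def Nb_def)
  have income_int: "integrable ?M (premium_income X (\<lambda>_ _ _ _. d) (\<lambda>_ _ _ _. d) t s v q Na Nb)"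
  proof -
    have "integrable ?M (\<lambda>\<omega>. d * real (Na ?T \<omega>) + d * real (Nb ?T \<omega>))"
      using standard_poisson_integrable[OF P(1) cT] standard_poisson_integrable[OF P(2) cT]
      by (simp add: NaT)
    also have "?this \<longleftrightarrow> integrable ?M (premium_income X (\<lambda>_ _ _ _. d) (\<lambda>_ _ _ _. d) t s v q Na Nb)"
      by (rule Bochner_Integration.integrable_cong) (simp_all add: income)
    finally show ?thesis .
  qed

  define b where "b \<omega> = (\<bar>real_of_int q\<bar> + real (Na ?T \<omega>) + real (Nb ?T \<omega>))\<^sup>2" for \<omega>
  define Q where "Q u \<omega> = real_of_int (option_inventory q Na Nb u \<omega>)" for u \<omega>
  \<comment> \<open>The risk rate with the Delta hedge inserted and time restricted to the open
    interval. In this form it inherits joint measurability from the cut-off vega rate.\<close>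
  define R where "R u \<omega> = (xi X)\<^sup>2 * (Q u \<omega>)\<^sup>2 * (indicator {t<..<?T} u * vega_rate X t s v u \<omega>)" for u \<omega>
  define risk where "risk = risk_rate X t s v q Na Nb"
  have risk: "indicator {t<..<?T} u * risk u \<omega> = R u \<omega>" if "\<omega> \<in> space ?M" for u \<omega>
  proof (cases "u \<in> {t<..<?T}")
    case True
    then have "inventory_variance_rate X
        (hedge X (stock X t s v u \<omega>) (vari X t s v u \<omega>) (option_inventory q Na Nb u \<omega>) u)
        (real_of_int (option_inventory q Na Nb u \<omega>)) (stock X t s v u \<omega>) (vari X t s v u \<omega>) u =
      vari X t s v u \<omega> * (xi X)\<^sup>2 *
        (d_v (call X) (stock X t s v u \<omega>) (vari X t s v u \<omega>) u)\<^sup>2 * (Q u \<omega>)\<^sup>2"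
      unfolding Q_def using heston_paths(1)[OF market(1) tv that, of u] tT
      by (intro inventory_variance_rate_delta_hedged[OF hedged]) auto
    then show ?thesis
      using True by (simp add: risk_def risk_rate_def Let_def R_def vega_rate_def)
  qed (simp add: R_def)
  have Q_le: "(Q u \<omega>)\<^sup>2 \<le> b \<omega>" if "\<omega> \<in> space ?M" "u \<le> ?T" for u \<omega>
  proof -
    have "Na u \<omega> \<le> Na ?T \<omega>" "Nb u \<omega> \<le> Nb ?T \<omega>"
      using clock_flow_mono[OF P(1) lam(3) that(1), of t] clock_flow_mono[OF P(2) lam(3) that(1), of t]
        that(2) by (auto simp: Na_def Nb_def mono_def)
    then have "\<bar>Q u \<omega>\<bar> \<le> \<bar>real_of_int q\<bar> + real (Na ?T \<omega>) + real (Nb ?T \<omega>)"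
      by (simp add: Q_def option_inventory_def)
    then show ?thesis
      unfolding b_def by (metis abs_ge_zero power2_abs power_mono)
  qed
  have R_nonneg: "0 \<le> R u \<omega>" if "\<omega> \<in> space ?M" for u \<omega>
    using vega_rate_nonneg[OF market(1) tv that, of u] by (auto simp: R_def indicator_def)
  have R_le: "R u \<omega> \<le> (xi X)\<^sup>2 * b \<omega> * (indicator {t<..<?T} u * vega_rate X t s v u \<omega>)"
    if "\<omega> \<in> space ?M" for u \<omega>
    using vega_rate_nonneg[OF market(1) tv that, of u] Q_le[OF that, of u]
    by (auto simp: R_def indicator_def intro!: mult_right_mono mult_left_mono)

  have [measurable]: "(\<lambda>z. real (Na (fst z) (snd z))) \<in> borel_measurable (borel \<Otimes>\<^sub>M ?M)"
    "(\<lambda>z. real (Nb (fst z) (snd z))) \<in> borel_measurable (borel \<Otimes>\<^sub>M ?M)"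
    using measurable_clock_flow_pair[OF P(1) lam(3), of t] measurable_clock_flow_pair[OF P(2) lam(3), of t]
    by (simp_all add: Na_def Nb_def case_prod_beta')
  have "subalgebra ?M (filt X ?T)"
    using market(1) by (simp add: heston_market_def)
  \<comment> \<open>The identity is measurable from the full space to the market sigma-algebra;
    composing with it transfers joint measurability of the vega rate to \<open>pspace X\<close>,
    where the counts live.\<close>
  then have "(\<lambda>z. (fst z, snd z)) \<in> measurable (borel \<Otimes>\<^sub>M ?M) (borel \<Otimes>\<^sub>M filt X ?T)"
    by (intro measurable_Pair measurable_fst measurable_compose[OF measurable_snd]
        measurable_from_subalg[OF _ measurable_ident_sets[OF refl]])
  from measurable_compose[OF this measurable_vega_rate[OF market(1) C tv, of s]]
  have [measurable]: "(\<lambda>z. indicator {t<..<?T} (fst z) * vega_rate X t s v (fst z) (snd z))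
      \<in> borel_measurable (borel \<Otimes>\<^sub>M ?M)"
    by (simp add: case_prod_beta')
  have "(\<lambda>z. (xi X)\<^sup>2 * (real_of_int q + real (Nb (fst z) (snd z)) - real (Na (fst z) (snd z)))\<^sup>2 *
      (indicator {t<..<?T} (fst z) * vega_rate X t s v (fst z) (snd z))) \<in> borel_measurable (borel \<Otimes>\<^sub>M ?M)"
    by measurable
  then have R_meas: "(\<lambda>z. R (fst z) (snd z)) \<in> borel_measurable (borel \<Otimes>\<^sub>M ?M)"
    by (simp add: R_def Q_def option_inventory_def)
  have R_meas_u: "(\<lambda>u. R u \<omega>) \<in> borel_measurable borel" if "\<omega> \<in> space ?M" for \<omega>
    using measurable_compose[OF measurable_Pair2'[OF that] R_meas] by simp
  have fin: "AE \<omega> in ?M. integrable lborel (\<lambda>u. indicator {t<..<?T} u * vega_rate X t s v u \<omega>)"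
    using finite tv by (auto simp: vega_risk_finite_def interval_integral_lborel_eq(2) vega_rate_def)
  \<comment> \<open>Pathwise, the bound \<open>b\<close> on the squared inventory does not depend on
    time and leaves the time integral, so vega risk remains.\<close>
  have R_int: "AE \<omega> in ?M. integrable lborel (\<lambda>u. R u \<omega>) \<and> (\<integral>u. R u \<omega> \<partial>lborel) \<le> (xi X)\<^sup>2 * (?Z \<omega> * b \<omega>)"
    using fin AE_space
  proof eventually_elim
    fix \<omega> assume int: "integrable lborel (\<lambda>u. indicator {t<..<?T} u * vega_rate X t s v u \<omega>)"
      and \<omega>: "\<omega> \<in> space ?M"
    let ?B = "\<lambda>u. (xi X)\<^sup>2 * b \<omega> * (indicator {t<..<?T} u * vega_rate X t s v u \<omega>)"
    have intB: "integrable lborel ?B" using int by simp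
    have intR: "integrable lborel (\<lambda>u. R u \<omega>)"
    proof (rule Bochner_Integration.integrable_bound[OF intB])
      show "(\<lambda>u. R u \<omega>) \<in> borel_measurable lborel" using R_meas_u[OF \<omega>] by simp
      show "AE u in lborel. norm (R u \<omega>) \<le> norm (?B u)"
        using R_le[OF \<omega>] R_nonneg[OF \<omega>] by (auto intro: order_trans[OF _ abs_ge_self])
    qed
    have "(\<integral>u. R u \<omega> \<partial>lborel) \<le> (\<integral>u. ?B u \<partial>lborel)"
      by (rule integral_mono[OF intR intB R_le[OF \<omega>]])
    also have "\<dots> = (xi X)\<^sup>2 * (?Z \<omega> * b \<omega>)"
      by (simp add: vega_risk_eq[OF tv(1)])
    finally show "integrable lborel (\<lambda>u. R u \<omega>) \<and> (\<integral>u. R u \<omega> \<partial>lborel) \<le> (xi X)\<^sup>2 * (?Z \<omega> * b \<omega>)"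
      using intR by blast
  qed
  have Zb: "integrable ?M (\<lambda>\<omega>. ?Z \<omega> * b \<omega>)"
    unfolding b_def NaT by (rule vega_risk_clock_integrable[OF market C finite tv cT])
  have IR: "integrable ?M (\<lambda>\<omega>. \<integral>u. R u \<omega> \<partial>lborel)"
  proof (rule Bochner_Integration.integrable_bound)
    show "integrable ?M (\<lambda>\<omega>. (xi X)\<^sup>2 * (?Z \<omega> * b \<omega>))" using Zb by simp
    have "(\<lambda>z. R (snd z) (fst z)) \<in> borel_measurable (?M \<Otimes>\<^sub>M borel)"
      using measurable_pair_swap[OF R_meas] by (simp add: case_prod_beta')
    then have "(\<lambda>(\<omega>, u). R u \<omega>) \<in> borel_measurable (?M \<Otimes>\<^sub>M lborel)"
      by (simp add: case_prod_beta' cong: measurable_cong_sets)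
    then show "(\<lambda>\<omega>. \<integral>u. R u \<omega> \<partial>lborel) \<in> borel_measurable ?M"
      by (rule lborel.borel_measurable_lebesgue_integral)
    show "AE \<omega> in ?M. norm (\<integral>u. R u \<omega> \<partial>lborel) \<le> norm ((xi X)\<^sup>2 * (?Z \<omega> * b \<omega>))"
      using R_int AE_space
    proof eventually_elim
      fix \<omega> assume *: "integrable lborel (\<lambda>u. R u \<omega>) \<and> (\<integral>u. R u \<omega> \<partial>lborel) \<le> (xi X)\<^sup>2 * (?Z \<omega> * b \<omega>)"
        and \<omega>: "\<omega> \<in> space ?M"
      have "0 \<le> (\<integral>u. R u \<omega> \<partial>lborel)" using R_nonneg[OF \<omega>] by (intro integral_nonneg_AE) auto
      then show "norm (\<integral>u. R u \<omega> \<partial>lborel) \<le> norm ((xi X)\<^sup>2 * (?Z \<omega> * b \<omega>))" using * by simp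
    qed
  qed
  have risk_eq: "(LBINT u=t..?T. risk u \<omega>) = (\<integral>u. R u \<omega> \<partial>lborel)" if "\<omega> \<in> space ?M" for \<omega>
    using risk[OF that] tT by (simp add: interval_integral_lborel_eq)
  have risk_int: "integrable ?M (\<lambda>\<omega>. LBINT u=t..?T. risk u \<omega>)"
  proof -
    have "?thesis \<longleftrightarrow> integrable ?M (\<lambda>\<omega>. \<integral>u. R u \<omega> \<partial>lborel)"
      by (rule Bochner_Integration.integrable_cong) (simp_all add: risk_eq)
    with IR show ?thesis by blast
  qed
  have "AE \<omega> in ?M. interval_lebesgue_integrable lborel t ?T (\<lambda>u. risk u \<omega>)"
    using R_int AE_space
    by eventually_elim (simp add: interval_integral_lborel_eq(2) tT risk)
  then show ?adm
    unfolding admissible_def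
    using of income_int risk_int
    by (auto simp: feedback_measurable_def risk_def case_prod_beta')

  have gam: "0 \<le> gam X" using market(1) by (simp add: heston_market_def)
  \<comment> \<open>The lower bound compares integrands: nonnegative income is dropped and, since
    \<open>gam X\<close> is nonnegative, the risk is replaced by its majorant.\<close>
  have "- (gam X / 2) * (xi X)\<^sup>2 * (LINT \<omega>|?M. ?Z \<omega> * b \<omega>) =
      (LINT \<omega>|?M. - (gam X / 2) * ((xi X)\<^sup>2 * (?Z \<omega> * b \<omega>)))"
    by simp
  also have "\<dots> \<le> expected_gain X (\<lambda>_ _ _ _. d) (\<lambda>_ _ _ _. d) t s v q Na Nb"
    unfolding expected_gain_def risk_def[symmetric]
  proof (rule integral_mono_AE)
    show "integrable ?M (\<lambda>\<omega>. - (gam X / 2) * ((xi X)\<^sup>2 * (?Z \<omega> * b \<omega>)))"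
      using Zb by simp
    show "integrable ?M (\<lambda>\<omega>. premium_income X (\<lambda>_ _ _ _. d) (\<lambda>_ _ _ _. d) t s v q Na Nb \<omega> -
        gam X / 2 * (LBINT u=t..?T. risk u \<omega>))"
      using income_int risk_int by simp
    show "AE \<omega> in ?M. - (gam X / 2) * ((xi X)\<^sup>2 * (?Z \<omega> * b \<omega>)) \<le>
        premium_income X (\<lambda>_ _ _ _. d) (\<lambda>_ _ _ _. d) t s v q Na Nb \<omega> -
        gam X / 2 * (LBINT u=t..?T. risk u \<omega>)"
      using R_int AE_space
    proof eventually_elim
      fix \<omega> assume *: "integrable lborel (\<lambda>u. R u \<omega>) \<and> (\<integral>u. R u \<omega> \<partial>lborel) \<le> (xi X)\<^sup>2 * (?Z \<omega> * b \<omega>)"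
        and \<omega>: "\<omega> \<in> space ?M"
      have "gam X / 2 * (\<integral>u. R u \<omega> \<partial>lborel) \<le> gam X / 2 * ((xi X)\<^sup>2 * (?Z \<omega> * b \<omega>))"
        using * gam by (intro mult_left_mono) auto
      moreover have "0 \<le> d * real (Na ?T \<omega>) + d * real (Nb ?T \<omega>)" using lam(4) by simp
      ultimately show "- (gam X / 2) * ((xi X)\<^sup>2 * (?Z \<omega> * b \<omega>)) \<le>
          premium_income X (\<lambda>_ _ _ _. d) (\<lambda>_ _ _ _. d) t s v q Na Nb \<omega> -
          gam X / 2 * (LBINT u=t..?T. risk u \<omega>)"
        unfolding income[OF \<omega>] risk_eq[OF \<omega>] by linarith
    qed
  qed
  finally show ?gain
    by (simp add: b_def NaT)
qed

section \<open>Lower bound for the exact value function and value of the inactive trader\<close>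

lemma value_ge_inactive:
  fixes X :: "'w dealer_model" and q :: int
  assumes market: "heston_market X" "order_clocks X" and C: "C122 (horizon X) (call X)"
    and intensities: "A > 0" "k > 0"
      "\<forall>\<delta>. lam_a X \<delta> = A * exp (- k * \<delta>)" "\<forall>\<delta>. lam_b X \<delta> = A * exp (- k * \<delta>)"
    and hedged: "delta_hedged X" and finite: "vega_risk_finite X" and V: "is_value_function X V"
    and tv: "t \<in> {0..horizon X}" "0 \<le> v"
  shows "- (gam X / 2) * (xi X)\<^sup>2 * (LINT \<omega>|pspace X. vega_risk X s v t \<omega>) * (real_of_int q)\<^sup>2 \<le> V s v q t"
proof -
  let ?M = "pspace X" and ?T = "horizon X" and ?Z = "vega_risk X s v t"
  have tT: "t \<le> ?T" using tv by auto
  have P: "standard_poisson ?M (clock_a X)" "standard_poisson ?M (clock_b X)"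
    using market(2) by (auto simp: order_clocks_def)
  define c where "c n = A * exp (- k * real n)" for n
  \<comment> \<open>The clock time used up between \<open>t\<close> and the horizon when both
    premiums equal \<open>n\<close>; \<open>c n\<close> is the corresponding arrival rate.\<close>
  define \<tau> where "\<tau> n = c n * (?T - t)" for n
  define b where "b y \<omega> = (\<bar>real_of_int q\<bar> + real (clock_a X y \<omega>) + real (clock_b X y \<omega>))\<^sup>2" for y \<omega>
  have c: "0 < c n" "c n \<le> A" for n using intensities by (auto simp: c_def)
  have \<tau>: "0 \<le> \<tau> n" "\<tau> n \<le> A * (?T - t)" for n
    using c[of n] tT by (auto simp: \<tau>_def intro!: mult_right_mono)
  have "filterlim (\<lambda>n. k * real n) at_top sequentially"
    using intensities by (intro filterlim_tendsto_pos_mult_at_top[OF tendsto_const] filterlim_real_sequentially)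
  then have "(\<lambda>n. exp (- (k * real n))) \<longlonglongrightarrow> 0"
    by (intro filterlim_compose[OF exp_at_bot]) (simp add: filterlim_uminus_at_bot)
  then have "(\<lambda>n. A * exp (- (k * real n)) * (?T - t)) \<longlonglongrightarrow> A * 0 * (?T - t)"
    by (intro tendsto_intros)
  then have \<tau>_lim: "\<tau> \<longlonglongrightarrow> 0" by (simp add: \<tau>_def[abs_def] c_def)
  \<comment> \<open>An integer-valued path that starts at 0 and is right continuous stays at 0 for a
    positive time, and \<open>\<tau> n\<close> eventually falls below that time.\<close>
  have clock_lim: "\<forall>\<^sub>F n in sequentially. Pc (\<tau> n) \<omega> = 0"
    if Pc: "standard_poisson ?M Pc" and \<omega>: "\<omega> \<in> space ?M" for Pc \<omega>
  proof -
    have "continuous (at_right 0) (\<lambda>r. Pc r \<omega>)" and P0: "Pc 0 \<omega> = 0"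
      using Pc \<omega> by (auto simp: standard_poisson_def)
    then have "\<forall>\<^sub>F r in at_right 0. Pc r \<omega> = 0"
      by (simp add: continuous_within tendsto_discrete)
    then obtain e where e: "0 < e" "\<And>r. 0 < r \<Longrightarrow> r < e \<Longrightarrow> Pc r \<omega> = 0"
      unfolding eventually_at_right_field by blast
    have "\<forall>\<^sub>F n in sequentially. \<tau> n < e" using order_tendstoD(2)[OF \<tau>_lim e(1)] .
    then show ?thesis
    proof eventually_elim
      fix n assume "\<tau> n < e"
      then show "Pc (\<tau> n) \<omega> = 0" using e(2)[of "\<tau> n"] \<tau>(1)[of n] P0 by (cases "\<tau> n = 0") auto
    qed
  qed
  \<comment> \<open>The dominating function belongs to premium 0, whose rate \<open>A\<close> is the
    largest among the \<open>c n\<close>; clocks are nondecreasing, so it bounds all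
    \<open>n\<close> at once.\<close>
  have bound: "integrable ?M (\<lambda>\<omega>. ?Z \<omega> * b (A * (?T - t)) \<omega>)"
    unfolding b_def using intensities tT by (intro vega_risk_clock_integrable[OF market C finite tv]) auto
  have meas: "(\<lambda>\<omega>. ?Z \<omega> * b (\<tau> n) \<omega>) \<in> borel_measurable ?M" for n
    unfolding b_def
    by (intro borel_measurable_integrable vega_risk_clock_integrable[OF market C finite tv] \<tau>)
  have Z_meas: "?Z \<in> borel_measurable ?M"
    using finite tv by (auto simp: vega_risk_finite_def intro!: borel_measurable_integrable)
  have "(\<lambda>n. LINT \<omega>|?M. ?Z \<omega> * b (\<tau> n) \<omega>) \<longlonglongrightarrow> (LINT \<omega>|?M. ?Z \<omega> * (real_of_int q)\<^sup>2)"
  proof (rule integral_dominated_convergence[OF _ meas bound])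
    show "(\<lambda>\<omega>. ?Z \<omega> * (real_of_int q)\<^sup>2) \<in> borel_measurable ?M" using Z_meas by simp
    show "AE \<omega> in ?M. (\<lambda>n. ?Z \<omega> * b (\<tau> n) \<omega>) \<longlonglongrightarrow> ?Z \<omega> * (real_of_int q)\<^sup>2"
    proof (rule AE_I2)
      fix \<omega> assume \<omega>: "\<omega> \<in> space ?M"
      have "\<forall>\<^sub>F n in sequentially. ?Z \<omega> * b (\<tau> n) \<omega> = ?Z \<omega> * (real_of_int q)\<^sup>2"
        using clock_lim[OF P(1) \<omega>] clock_lim[OF P(2) \<omega>] by eventually_elim (simp add: b_def)
      then show "(\<lambda>n. ?Z \<omega> * b (\<tau> n) \<omega>) \<longlonglongrightarrow> ?Z \<omega> * (real_of_int q)\<^sup>2"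
        by (rule tendsto_eventually)
    qed
    show "AE \<omega> in ?M. norm (?Z \<omega> * b (\<tau> n) \<omega>) \<le> ?Z \<omega> * b (A * (?T - t)) \<omega>" for n
    proof (rule AE_I2)
      fix \<omega> assume \<omega>: "\<omega> \<in> space ?M"
      have "mono_on {0..} (\<lambda>u. clock_a X u \<omega>)" "mono_on {0..} (\<lambda>u. clock_b X u \<omega>)"
        using P \<omega> by (auto simp: standard_poisson_def)
      then have "clock_a X (\<tau> n) \<omega> \<le> clock_a X (A * (?T - t)) \<omega>"
        "clock_b X (\<tau> n) \<omega> \<le> clock_b X (A * (?T - t)) \<omega>"
        using \<tau>[of n] by (auto elim!: mono_onD)
      then have "b (\<tau> n) \<omega> \<le> b (A * (?T - t)) \<omega>"
        unfolding b_def by (intro power_mono) auto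
      moreover have "0 \<le> b (\<tau> n) \<omega>" by (simp add: b_def)
      ultimately show "norm (?Z \<omega> * b (\<tau> n) \<omega>) \<le> ?Z \<omega> * b (A * (?T - t)) \<omega>"
        using vega_risk_nonneg[OF market(1) tv \<omega>] by (simp add: abs_mult mult_left_mono)
    qed
  qed
  then have "(\<lambda>n. - (gam X / 2) * (xi X)\<^sup>2 * (LINT \<omega>|?M. ?Z \<omega> * b (\<tau> n) \<omega>)) \<longlonglongrightarrow>
      - (gam X / 2) * (xi X)\<^sup>2 * (LINT \<omega>|?M. ?Z \<omega> * (real_of_int q)\<^sup>2)"
    by (intro tendsto_mult_left)
  \<comment> \<open>Each constant premium is admissible, so its gain is at most \<open>V\<close>,
    and this persists in the limit.\<close>
  moreover have "- (gam X / 2) * (xi X)\<^sup>2 * (LINT \<omega>|?M. ?Z \<omega> * b (\<tau> n) \<omega>) \<le> V s v q t" for n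
  proof -
    have lam: "lam_a X (real n) = c n" "lam_b X (real n) = c n"
      using intensities by (auto simp: c_def)
    note gain = constant_premium_gain[OF market C hedged finite tv lam c(1) of_nat_0_le_iff, of s q]
    have "expected_gain X (\<lambda>_ _ _ _. real n) (\<lambda>_ _ _ _. real n) t s v q
        (clock_flow (clock_a X) (c n) t) (clock_flow (clock_b X) (c n) t) \<le> V s v q t"
      using V tv gain(1) unfolding is_value_function_def by blast
    with gain(2) show ?thesis
      unfolding b_def \<tau>_def by linarith
  qed
  ultimately have "- (gam X / 2) * (xi X)\<^sup>2 * (LINT \<omega>|?M. ?Z \<omega> * (real_of_int q)\<^sup>2) \<le> V s v q t"
    by (intro LIMSEQ_le_const2[of "\<lambda>n. - (gam X / 2) * (xi X)\<^sup>2 * (LINT \<omega>|?M. ?Z \<omega> * b (\<tau> n) \<omega>)"]) auto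
  then show ?thesis by simp
qed

text \<open>Without orders both jump sums are empty and the inventory stays at \<open>q\<close>. The
  Delta-hedged risk rate is then a constant multiple of the vega rate, and the constant leaves both
  integrals.\<close>

lemma inactive_value_eq:
  assumes market: "heston_market X" and hedged: "delta_hedged X"
    and tv: "t \<in> {0..horizon X}" "0 \<le> v"
  shows "inactive_value X s v q t =
    - (gam X / 2) * (xi X)\<^sup>2 * (LINT \<omega>|pspace X. vega_risk X s v t \<omega>) * (real_of_int q)\<^sup>2"
proof -
  have jumps: "jump_integral t (horizon X) \<delta> (\<lambda>_. 0) = 0" for \<delta>
    by (simp add: jump_integral_def tendsto_Lim)
  have risk: "(LBINT u=t..horizon X. risk_rate X t s v q (\<lambda>_ _. 0) (\<lambda>_ _. 0) u \<omega>) =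
      (xi X)\<^sup>2 * (real_of_int q)\<^sup>2 * vega_risk X s v t \<omega>" if "\<omega> \<in> space (pspace X)" for \<omega>
  proof -
    have "(LBINT u=t..horizon X. risk_rate X t s v q (\<lambda>_ _. 0) (\<lambda>_ _. 0) u \<omega>) =
      (LBINT u=t..horizon X. (xi X)\<^sup>2 * (real_of_int q)\<^sup>2 * (vari X t s v u \<omega> *
         (d_v (call X) (stock X t s v u \<omega>) (vari X t s v u \<omega>) u)\<^sup>2))"
    proof (rule interval_integral_cong)
      fix u assume "u \<in> einterval (min (ereal t) (ereal (horizon X))) (max (ereal t) (ereal (horizon X)))"
      then have u: "u \<in> {t..horizon X}" using tv by (auto simp: min_def max_def)
      have "inventory_variance_rate X (hedge X (stock X t s v u \<omega>) (vari X t s v u \<omega>) q u)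
          (real_of_int q) (stock X t s v u \<omega>) (vari X t s v u \<omega>) u =
          vari X t s v u \<omega> * (xi X)\<^sup>2 *
            (d_v (call X) (stock X t s v u \<omega>) (vari X t s v u \<omega>) u)\<^sup>2 * (real_of_int q)\<^sup>2"
        using u tv heston_paths(1)[OF market tv that u]
        by (intro inventory_variance_rate_delta_hedged[OF hedged]) auto
      then show "risk_rate X t s v q (\<lambda>_ _. 0) (\<lambda>_ _. 0) u \<omega> = (xi X)\<^sup>2 * (real_of_int q)\<^sup>2 *
          (vari X t s v u \<omega> * (d_v (call X) (stock X t s v u \<omega>) (vari X t s v u \<omega>) u)\<^sup>2)"
        by (simp add: risk_rate_def option_inventory_def Let_def)
    qed
    then show ?thesis by (simp add: vega_risk_def)
  qed
  have "inactive_value X s v q t = (LINT \<omega>|pspace X. - (gam X / 2) * (xi X)\<^sup>2 * (real_of_int q)\<^sup>2 * vega_risk X s v t \<omega>)"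
    unfolding inactive_value_def expected_gain_def
    by (rule Bochner_Integration.integral_cong) (simp_all add: premium_income_def jumps risk)
  then show ?thesis by simp
qed

section \<open>Solution of the approximate treatment\<close>

text \<open>The polynomial selected by \<open>THE\<close> is unique: the difference of two
  candidates vanishes at all integers, and a nonzero polynomial has finitely many roots.\<close>

lemma q_coeff_poly:
  assumes "\<And>q. f q = poly p (real_of_int q)"
  shows "q_coeff f i = coeff p i"
proof -
  have "(THE r. \<forall>q. poly r (real_of_int q) = f q) = p"
  proof (rule the_equality)
    show "\<forall>q. poly p (real_of_int q) = f q" by (simp add: assms)
    fix r assume r: "\<forall>q. poly r (real_of_int q) = f q"
    show "r = p"
    proof (rule ccontr)
      assume "r \<noteq> p"
      then have "finite {x. poly (r - p) x = 0}" by (intro poly_roots_finite) simp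
      moreover have "range real_of_int \<subseteq> {x. poly (r - p) x = 0}" using r by (auto simp: assms)
      ultimately have "finite (range real_of_int)" by (rule rev_finite_subset)
      then have "finite (UNIV :: int set)" by (rule finite_imageD) (simp add: inj_def)
      then show False using infinite_UNIV_int by simp
    qed
  qed
  then show ?thesis by (simp add: q_coeff_def)
qed

text \<open>The sum of the two premiums is \<open>2 / k\<close> minus a second difference of the
  quadratic in \<open>q\<close>, which is the constant \<open>2 * V2\<close>. The linearised arrival
  term is thus \<open>2 * A * V2\<close>, which enters only the coefficient of degree 0.\<close>

lemma hjb_source_quadratic:
  assumes "k \<noteq> 0"
  shows "q_coeff (\<lambda>q. hjb_source X (arrival_linear A k (quadratic_in_q (\<lambda>_ _ _. 0) V1 V2)) s v q t) 1 = 0"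
    and "q_coeff (\<lambda>q. hjb_source X (arrival_linear A k (quadratic_in_q (\<lambda>_ _ _. 0) V1 V2)) s v q t) 2 =
      - (gam X / 2) * (xi X)\<^sup>2 * (v * (d_v (call X) s v t)\<^sup>2)"
proof -
  have "hjb_source X (arrival_linear A k (quadratic_in_q (\<lambda>_ _ _. 0) V1 V2)) s v q t =
      poly [:2 * A * V2 s v t, 0, - (gam X / 2) * (xi X)\<^sup>2 * (v * (d_v (call X) s v t)\<^sup>2):] (real_of_int q)" for q
    using assms
    by (simp add: hjb_source_def arrival_linear_def ask_premium_def bid_premium_def quadratic_in_q_def
        field_simps power2_eq_square)
  note * = q_coeff_poly[OF this]
  show "q_coeff (\<lambda>q. hjb_source X (arrival_linear A k (quadratic_in_q (\<lambda>_ _ _. 0) V1 V2)) s v q t) 1 = 0"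
    "q_coeff (\<lambda>q. hjb_source X (arrival_linear A k (quadratic_in_q (\<lambda>_ _ _. 0) V1 V2)) s v q t) 2 =
      - (gam X / 2) * (xi X)\<^sup>2 * (v * (d_v (call X) s v t)\<^sup>2)"
    unfolding * by (simp_all add: numeral_2_eq_2)
qed

text \<open>Read off from the Feynman-Kac representation: the source for \<open>V1\<close> is zero,
  and that for \<open>V2\<close> is a constant times the integrand of
  \<open>vega_risk\<close>.\<close>

lemma approximate_treatment_solution:
  assumes "approximate_treatment X A k V1 V2" "k \<noteq> 0" "t \<in> {0..horizon X}" "0 \<le> v"
  shows "V1 s v t = 0"
    and "V2 s v t = - (gam X / 2) * (xi X)\<^sup>2 * (LINT \<omega>|pspace X. vega_risk X s v t \<omega>)"
proof -
  let ?f = "\<lambda>i s v t. q_coeff (\<lambda>q. hjb_source X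
    (arrival_linear A k (quadratic_in_q (\<lambda>_ _ _. 0) V1 V2)) s v q t) i"
  have "V1 s v t = feynman_kac X (?f 1) s v t" "V2 s v t = feynman_kac X (?f 2) s v t"
    using assms(1,3,4) by (auto simp: approximate_treatment_def Let_def)
  then show "V1 s v t = 0"
    "V2 s v t = - (gam X / 2) * (xi X)\<^sup>2 * (LINT \<omega>|pspace X. vega_risk X s v t \<omega>)"
    unfolding hjb_source_quadratic[OF assms(2)] feynman_kac_def vega_risk_def
    by (simp, simp only: interval_lebesgue_integral_mult_right integral_mult_right_zero)
qed

theorem theorem4p8:
  fixes X :: "'w dealer_model"
    and A k K :: real
    and lam_nu :: "real \<Rightarrow> real \<Rightarrow> real \<Rightarrow> real"
    and V :: "real \<Rightarrow> real \<Rightarrow> int \<Rightarrow> real \<Rightarrow> real"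
    and V1 V2 M :: "real \<Rightarrow> real \<Rightarrow> real \<Rightarrow> real"
    and Vt :: "real \<Rightarrow> real \<Rightarrow> int \<Rightarrow> real \<Rightarrow> real"
  assumes market: "heston_market X" "order_clocks X"
    and call: "call_price X lam_nu K"
    and intensities: "A > 0" "k > 0"
      "\<forall>\<delta>. lam_a X \<delta> = A * exp (- k * \<delta>)" "\<forall>\<delta>. lam_b X \<delta> = A * exp (- k * \<delta>)"
    and hedged: "delta_hedged X"
    and finite: "vega_risk_finite X"
    and exact: "is_value_function X V"
      "\<forall>q. C122 (horizon X) (\<lambda>s v t. V s v q t)"
      "solves_hjb X A k V"
    and treatment: "approximate_treatment X A k V1 V2"
      "Vt = quadratic_in_q (\<lambda>_ _ _. 0) V1 V2"
    and M: "\<forall>s v t. M s v t = - (gam X / 2) * (xi X)\<^sup>2 * (LINT \<omega>|pspace X. vega_risk X s v t \<omega>)"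
  shows "\<forall>t\<in>{0..horizon X}. \<forall>s. \<forall>v\<ge>0. \<forall>q.
      ask_premium k Vt s v q t = 1 / k + M s v t * (2 * real_of_int q - 1) \<and>
      bid_premium k Vt s v q t = 1 / k - M s v t * (2 * real_of_int q + 1) \<and>
      Vt s v q t = - (gam X / 2) * (xi X)\<^sup>2 * (LINT \<omega>|pspace X. vega_risk X s v t \<omega>) * (real_of_int q)\<^sup>2 \<and>
      Vt s v q t = inactive_value X s v q t \<and>
      V s v q t \<ge> Vt s v q t"
proof (intro ballI allI impI)
  fix t s v q assume tv: "t \<in> {0..horizon X}" "0 \<le> (v::real)"
  have C: "C122 (horizon X) (call X)" using call by (simp add: call_price_def)
  have "k \<noteq> 0" using intensities by simp
  note sol = approximate_treatment_solution[OF treatment(1) this tv, of s, folded M[rule_format]]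
  \<comment> \<open>Stated for every inventory, since the premiums also evaluate \<open>Vt\<close>
    at \<open>q - 1\<close> and \<open>q + 1\<close>. Differences of squares then produce the
    factors \<open>2 * q - 1\<close> and \<open>2 * q + 1\<close>.\<close>
  have Vt: "Vt s v q t = M s v t * (real_of_int q)\<^sup>2" for q
    by (simp add: treatment(2) quadratic_in_q_def sol)
  have "ask_premium k Vt s v q t = 1 / k + M s v t * (2 * real_of_int q - 1)"
    "bid_premium k Vt s v q t = 1 / k - M s v t * (2 * real_of_int q + 1)"
    by (simp_all add: ask_premium_def bid_premium_def Vt power2_eq_square algebra_simps)
  moreover have "Vt s v q t = inactive_value X s v q t"
    by (simp add: Vt M inactive_value_eq[OF market(1) hedged tv])
  moreover have "Vt s v q t \<le> V s v q t"
    using value_ge_inactive[OF market C intensities hedged finite exact(1) tv, of s q] by (simp add: Vt M)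
  ultimately show "ask_premium k Vt s v q t = 1 / k + M s v t * (2 * real_of_int q - 1) \<and>
      bid_premium k Vt s v q t = 1 / k - M s v t * (2 * real_of_int q + 1) \<and>
      Vt s v q t = - (gam X / 2) * (xi X)\<^sup>2 * (LINT \<omega>|pspace X. vega_risk X s v t \<omega>) * (real_of_int q)\<^sup>2 \<and>
      Vt s v q t = inactive_value X s v q t \<and>
      V s v q t \<ge> Vt s v q t"
    by (simp add: Vt M)
qed

end
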